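(* Let $\mathcal E:0\to\mathfrak h\to\hat{\mathfrak g}\xrightarrow{p}\mathfrak g\to0$ be a non-abelian extension of Lie-Yamaguti algebras of $\mathfrak g$ by $\mathfrak h$ (and fix a section $s$ of $p$). There is an exact sequence $$0\longrightarrow Z^1_{nab}(\mathfrak g,\mathfrak h)\xrightarrow{\;i\;}\mathrm{Aut}_{\mathfrak h}(\hat{\mathfrak g})\xrightarrow{K}\mathrm{Aut}(\mathfrak g)\times\mathrm{Aut}(\mathfrak h)\xrightarrow{W}H^{(2,3)}_{nab}(\mathfrak g,\mathfrak h),$$ where $i(\varphi)(a+s(x))=a+s(x)-\varphi(x)$ for $\varphi\in Z^1_{nab}(\mathfrak g,\mathfrak h)$, $a\in\mathfrak h$, $x\in\mathfrak g$; $K(\gamma)=(p\gamma s,\gamma|_{\mathfrak h})$; and $W$ is the Wells map.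
   Context: **Lie-Yamaguti algebras.** All vector spaces and algebras are over a field $k$. A Lie-Yamaguti algebra is a vector space $\mathfrak g$ with a bilinear map $[\cdot,\cdot]$ and a trilinear map $\{\cdot,\cdot,\cdot\}$ such that for all elements $[x_1,x_2]+[x_2,x_1]=0$, $\{x_1,x_2,x_3\}+\{x_2,x_1,x_3\}=0$; $[[x_1,x_2],x_3]+[[x_2,x_3],x_1]+[[x_3,x_1],x_2]+\{x_1,x_2,x_3\}+\{x_2,x_3,x_1\}+\{x_3,x_1,x_2\}=0$; $\{[x_1,x_2],x_3,y_1\}+\{[x_2,x_3],x_1,y_1\}+\{[x_3,x_1],x_2,y_1\}=0$; $\{x_1,x_2,[y_1,y_2]\}=[\{x_1,x_2,y_1\},y_2]+[y_1,\{x_1,x_2,y_2\}]$; $\{x_1,x_2,\{y_1,y_2,y_3\}\}=\{\{x_1,x_2,y_1\},y_2,y_3\}+\{y_1,\{x_1,x_2,y_2\},y_3\}+\{y_1,y_2,\{x_1,x_2,y_3\}\}$. Homomorphisms are linear maps preserving both operations; $\mathrm{Aut}$ denotes the group of automorphisms. **Extensions.** A non-abelian extension of $\mathfrak g$ by $\mathfrak h$ is a short exact sequence of Lie-Yamaguti algebras $0\to\mathfrak h\to\hat{\mathfrak g}\xrightarrow{p}\mathfrak g\to0$; $\mathfrak h$ is identified with its image in $\hat{\mathfrak g}$. A section of $p$ is a linear map $s$ with $ps=I_{\mathfrak g}$; every element of $\hat{\mathfrak g}$ is uniquely $a+s(x)$ with $a\in\mathfrak h$, $x\in\mathfrak g$.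 $\mathrm{Aut}_{\mathfrak h}(\hat{\mathfrak g})=\{\gamma\in\mathrm{Aut}(\hat{\mathfrak g})\mid\gamma(\mathfrak h)=\mathfrak h\}$. **Induced cocycle.** The non-abelian $(2,3)$-cocycle induced by $s$ is: $\chi(x,y)=[s(x),s(y)]_{\hat{\mathfrak g}}-s[x,y]_{\mathfrak g}$, $\omega(x,y,z)=\{s(x),s(y),s(z)\}_{\hat{\mathfrak g}}-s\{x,y,z\}_{\mathfrak g}$, $\mu(x)a=[s(x),a]_{\hat{\mathfrak g}}$, $\theta(x,y)a=\{a,s(x),s(y)\}_{\hat{\mathfrak g}}$, $D(x,y)a=\{s(x),s(y),a\}_{\hat{\mathfrak g}}$, $\rho(x)(a,b)=\{s(x),a,b\}_{\hat{\mathfrak g}}$, $T(x)(a,b)=\{a,b,s(x)\}_{\hat{\mathfrak g}}$. **Non-abelian 1-cocycles.** With these maps, $Z^1_{nab}(\mathfrak g,\mathfrak h)$ is the set of linear maps $\varphi:\mathfrak g\to\mathfrak h$ such that for all $x,y,z\in\mathfrak g$, $a,b\in\mathfrak h$: $[a,\varphi(x)]=\{a,b,\varphi(x)\}=\{\varphi(x),a,b\}=0$; $\{\varphi(x),\varphi(y),a\}-\rho(x)(\varphi(y),a)+\rho(y)(\varphi(x),a)=0$; $\{a,\varphi(x),\varphi(y)\}-T(y)(a,\varphi(x))+\rho(x)(a,\varphi(y))=0$; $\mu(x)\varphi(y)-\mu(y)\varphi(x)=\varphi([x,y])+[\varphi(x),\varphi(y)]$; $T(z)(\varphi(x),\varphi(y))-\rho(y)(\varphi(x),\varphi(z))-\theta(y,z)\varphi(x)+\rho(x)(\varphi(y),\varphi(z))+\theta(x,z)\varphi(y)-D(x,y)\varphi(z)=\{\varphi(x),\varphi(y),\varphi(z)\}-\varphi(\{x,y,z\})$.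 It is an abelian group under pointwise addition. **Non-abelian $(2,3)$-cocycles.** A non-abelian $(2,3)$-cocycle on $\mathfrak g$ with values in $\mathfrak h$ is a septuple $(\chi,\omega,\mu,\theta,D,\rho,T)$ of (multi)linear maps $\chi:\mathfrak g\otimes\mathfrak g\to\mathfrak h$, $\omega:\mathfrak g^{\otimes3}\to\mathfrak h$, $\mu:\mathfrak g\to\mathfrak{gl}(\mathfrak h)$, $\theta,D:\mathfrak g\otimes\mathfrak g\to\mathfrak{gl}(\mathfrak h)$, $\rho,T:\mathfrak g\to\mathrm{Hom}(\mathfrak h\otimes\mathfrak h,\mathfrak h)$ such that for all $x,y,z,w,x_i,y_i\in\mathfrak g$ and $a,b,c,d\in\mathfrak h$ (brackets of $\mathfrak g$ and of $\mathfrak h$ are written without subscripts): (i) $\chi(x,y)+\chi(y,x)=0$; $\omega(x,y,z)+\omega(y,x,z)=0$; $D(x,y)a+D(y,x)a=0$; $T(x)(a,b)+T(x)(b,a)=0$. (ii) $\chi([x,y],z)-\mu(z)\chi(x,y)+\omega(x,y,z)+\chi([y,z],x)-\mu(x)\chi(y,z)+\omega(y,z,x)+\chi([z,x],y)-\mu(y)\chi(z,x)+\omega(z,x,y)=0$; $\mu([x,y])a+[\chi(x,y),a]+D(x,y)a-\mu(x)\mu(y)a-\theta(y,x)a+\mu(y)\mu(x)a+\theta(x,y)a=0$; $[\mu(x)a,b]+\rho(x)(a,b)-\mu(x)[a,b]+T(x)(a,b)-[\mu(x)b,a]-\rho(x)(b,a)=0$. (iii) $\omega([x,y],z,w)+\omega([y,z],x,w)+\omega([z,x],y,w)+\theta(z,w)\chi(x,y)+\theta(x,w)\chi(y,z)+\theta(y,w)\chi(z,x)=0$;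 $D([x,y],z)a-\rho(z)(\chi(x,y),a)+D([y,z],x)a-\rho(x)(\chi(y,z),a)+D([z,x],y)a-\rho(y)(\chi(z,x),a)=0$; $\theta([x,y],z)a-T(z)(\chi(x,y),a)-\theta(x,z)\mu(y)a+\theta(y,z)\mu(x)a=0$; $\rho([x,y])(a,b)+\{\chi(x,y),a,b\}-\rho(x)(\mu(y)a,b)+\rho(y)(\mu(x)a,b)=0$; $T(y)(\mu(x)a,b)+\theta(x,y)[a,b]-T(y)(\mu(x)b,a)=0$; $\{\mu(x)a,b,c\}-\rho(x)([a,b],c)-\{\mu(x)b,a,c\}=0$; $T(x)([a,b],c)+T(x)([b,c],a)+T(x)([c,a],b)=0$. (iv) $\omega(x,y,[z,w])+D(x,y)\chi(z,w)=\chi(\{x,y,z\},w)-\mu(w)\omega(x,y,z)+\mu(z)\omega(x,y,w)+\chi(z,\{x,y,w\})$; $D(x,y)\mu(z)a=\mu(\{x,y,z\})a+[\omega(x,y,z),a]+\mu(z)D(x,y)a$; $\theta(x,[y,z])a-\rho(x)(a,\chi(y,z))=\mu(y)\theta(x,z)a-\mu(z)\theta(x,y)a$; $D(x,y)[a,b]=[D(x,y)a,b]+[a,D(x,y)b]$; $\rho(x)(a,\mu(y)b)+[\theta(x,y)a,b]-\mu(y)\rho(x)(a,b)=0$; $T([x,y])(a,b)+\{a,b,\chi(x,y)\}-\mu(x)T(y)(a,b)+\mu(y)T(x)(a,b)=0$; $\{a,b,\mu(x)c\}=\mu(x)\{a,b,c\}-[c,T(x)(a,b)]$; $\rho(x)(a,[b,c])=[\rho(x)(a,b),c]+[b,\rho(x)(a,c)]$.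 (v) $D(x_1,x_2)\omega(y_1,y_2,y_3)+\omega(x_1,x_2,\{y_1,y_2,y_3\})=\omega(\{x_1,x_2,y_1\},y_2,y_3)+\theta(y_2,y_3)\omega(x_1,x_2,y_1)+\omega(y_1,\{x_1,x_2,y_2\},y_3)-\theta(y_1,y_3)\omega(x_1,x_2,y_2)+\omega(y_1,y_2,\{x_1,x_2,y_3\})+D(y_1,y_2)\omega(x_1,x_2,y_3)$; $D(x,y)\theta(z,w)a-\theta(z,w)D(x,y)a=\theta(\{x,y,z\},w)a+\theta(z,\{x,y,w\})a-T(w)(\omega(x,y,z),a)-\rho(z)(a,\omega(x,y,w))$; $\theta(x,\{y,z,w\})a-\rho(x)(a,\omega(y,z,w))=\theta(z,w)\theta(x,y)a-\theta(y,w)\theta(x,z)a+D(y,z)\theta(x,w)a$; $D(x,y)D(z,w)a-D(z,w)D(x,y)a=D(\{x,y,z\},w)a+D(z,\{x,y,w\})a-\rho(w)(\omega(x,y,z),a)+\rho(z)(\omega(x,y,w),a)$; $D(x,y)\rho(z)(a,b)-\rho(\{x,y,z\})(a,b)=\rho(z)(D(x,y)a,b)+\rho(z)(a,D(x,y)b)+\{\omega(x,y,z),a,b\}$; $D(y,z)\rho(x)(a,b)=\rho(x)(a,D(y,z)b)-\rho(z)(\theta(x,y)a,b)+\rho(y)(\theta(x,z)a,b)$; $\theta(y,z)\rho(x)(a,b)=\rho(x)(a,\theta(y,z)b)-T(z)(\theta(x,y)a,b)-\rho(y)(b,\theta(x,z)a)$; $D(x,y)T(z)(a,b)-T(\{x,y,z\})(a,b)=T(z)(D(x,y)a,b)+T(z)(a,D(x,y)b)+\{a,b,\omega(x,y,z)\}$;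 $T(\{x,y,z\})(a,b)-D(x,y)T(z)(a,b)+\{a,b,\omega(x,y,z)\}=\theta(y,z)T(x)(a,b)-\theta(x,z)T(y)(a,b)$; $D(x,y)\{a,b,c\}=\{D(x,y)a,b,c\}+\{a,D(x,y)b,c\}+\{a,b,D(x,y)c\}$; $\rho(x)(a,\rho(y)(b,c))=\rho(y)(\rho(x)(a,b),c)+\rho(y)(b,\rho(x)(a,c))-\{\theta(x,y)a,b,c\}$; $\{a,b,\theta(x,y)c\}=\theta(x,y)\{a,b,c\}-T(y)(T(x)(a,b),c)-\rho(x)(c,T(y)(a,b))$; $\rho(x)(a,T(y)(b,c))=T(y)(\rho(x)(a,b),c)+T(y)(b,\rho(x)(a,c))-\{b,c,\theta(x,y)a\}$; $\{a,b,D(x,y)c\}=D(x,y)\{a,b,c\}-\rho(y)(T(x)(a,b),c)+\rho(x)(T(y)(a,b),c)$; $\{a,b,\rho(x)(c,d)\}=\rho(x)(\{a,b,c\},d)-\{c,T(x)(a,b),d\}+\rho(x)(c,\{a,b,d\})$; $\rho(x)(a,\{b,c,d\})=\{\rho(x)(a,b),c,d\}+\{b,\rho(x)(a,c),d\}+\{b,c,\rho(x)(a,d)\}$; $\{a,b,T(x)(c,d)\}=T(x)(\{a,b,c\},d)+T(x)(c,\{a,b,d\})+\{c,d,T(x)(a,b)\}$. **Equivalence.** $(\chi_1,\omega_1,\mu_1,\theta_1,D_1,\rho_1,T_1)$ and $(\chi_2,\omega_2,\mu_2,\theta_2,D_2,\rho_2,T_2)$ are equivalent if there is a linear map $\varphi:\mathfrak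 g\to\mathfrak h$ such that for all $x,y,z\in\mathfrak g$, $a,b\in\mathfrak h$: $\chi_1(x,y)-\chi_2(x,y)=[\varphi(x),\varphi(y)]+\varphi[x,y]-\mu_2(x)\varphi(y)+\mu_2(y)\varphi(x)$; $\omega_1(x,y,z)-\omega_2(x,y,z)=\theta_2(x,z)\varphi(y)-D_2(x,y)\varphi(z)+\rho_2(x)(\varphi(y),\varphi(z))-\theta_2(y,z)\varphi(x)+T_2(z)(\varphi(x),\varphi(y))-\rho_2(y)(\varphi(x),\varphi(z))-\{\varphi(x),\varphi(y),\varphi(z)\}+\varphi\{x,y,z\}$; $\mu_1(x)a-\mu_2(x)a=[a,\varphi(x)]$; $\theta_1(x,y)a-\theta_2(x,y)a=\rho_2(x)(a,\varphi(y))-T_2(y)(a,\varphi(x))+\{a,\varphi(x),\varphi(y)\}$; $D_1(x,y)a-D_2(x,y)a=\rho_2(y)(\varphi(x),a)-\rho_2(x)(\varphi(y),a)+\{\varphi(x),\varphi(y),a\}$; $\rho_1(x)(a,b)-\rho_2(x)(a,b)=\{a,\varphi(x),b\}$; $T_1(x)(a,b)-T_2(x)(a,b)=\{b,a,\varphi(x)\}$. $H^{(2,3)}_{nab}(\mathfrak g,\mathfrak h)$ is the set of equivalence classes $[(\chi,\omega,\mu,\theta,D,\rho,T)]$ of non-abelian $(2,3)$-cocycles. **Wells map.** With $(\chi,\omega,\mu,\theta,D,\rho,T)$ induced by $s$ and $(\alpha,\beta)\in\mathrm{Aut}(\mathfrak g)\times\mathrm{Aut}(\mathfrak h)$, put $\chi_{(\alpha,\beta)}(x,y)=\beta\chi(\alpha^{-1}x,\alpha^{-1}y)$,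 $\omega_{(\alpha,\beta)}(x,y,z)=\beta\omega(\alpha^{-1}x,\alpha^{-1}y,\alpha^{-1}z)$, $\mu_{(\alpha,\beta)}(x)a=\beta\mu(\alpha^{-1}x)\beta^{-1}a$, $\theta_{(\alpha,\beta)}(x,y)a=\beta\theta(\alpha^{-1}x,\alpha^{-1}y)\beta^{-1}a$, $D_{(\alpha,\beta)}(x,y)a=\beta D(\alpha^{-1}x,\alpha^{-1}y)\beta^{-1}a$, $\rho_{(\alpha,\beta)}(x)(a,b)=\beta\rho(\alpha^{-1}x)(\beta^{-1}a,\beta^{-1}b)$, $T_{(\alpha,\beta)}(x)(a,b)=\beta T(\alpha^{-1}x)(\beta^{-1}a,\beta^{-1}b)$; this twisted septuple is again a non-abelian $(2,3)$-cocycle. The Wells map $W:\mathrm{Aut}(\mathfrak g)\times\mathrm{Aut}(\mathfrak h)\to H^{(2,3)}_{nab}(\mathfrak g,\mathfrak h)$ is defined by the class of the difference $$W(\alpha,\beta)=[(\chi_{(\alpha,\beta)},\omega_{(\alpha,\beta)},\mu_{(\alpha,\beta)},\theta_{(\alpha,\beta)},D_{(\alpha,\beta)},\rho_{(\alpha,\beta)},T_{(\alpha,\beta)})-(\chi,\omega,\mu,\theta,D,\rho,T)].$$ Membership $(\alpha,\beta)\in\mathrm{Ker}\,W$ is understood as: the twisted septuple and the original one are equivalent. The map $K:\mathrm{Aut}_{\mathfrak h}(\hat{\mathfrak g})\to\mathrm{Aut}(\mathfrak g)\times\mathrm{Aut}(\mathfrak h)$ is a group homomorphism. Exactness means: $i$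 is an injective group homomorphism, $\mathrm{Im}\,i=\mathrm{Ker}\,K$, $\mathrm{Im}\,K=\mathrm{Ker}\,W$.
   Formalization: A difference of non-abelian cocycles need not be a cocycle, so its class in H^(2,3)_nab may be undefined; here W(α,β) is the class of the twisted cocycle itself, with the class of the induced cocycle as base point. Ker W is as in the stated convention. *)

theory Defs
  imports
    "HOL.Vector_Spaces"
    "HOL-Algebra.Coset"
    "HOL-Library.FuncSet"
    "HOL-Library.Function_Algebras"
    "HOL-Library.Product_Plus"
begin

section \<open>Lie-Yamaguti algebras\<close>


record ('k, 'v) ly_algebra =
  smult :: "'k \<Rightarrow> 'v \<Rightarrow> 'v"
  bracket :: "'v \<Rightarrow> 'v \<Rightarrow> 'v"
  triple :: "'v \<Rightarrow> 'v \<Rightarrow> 'v \<Rightarrow> 'v"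

abbreviation ly_bracket
  :: "'v \<Rightarrow> 'v \<Rightarrow> ('k, 'v) ly_algebra \<Rightarrow> 'v"  (\<open>[_, _]\<^bsub>_\<^esub>\<close>) where
  "[x, y]\<^bsub>A\<^esub> \<equiv> bracket A x y"

abbreviation ly_triple
  :: "'v \<Rightarrow> 'v \<Rightarrow> 'v \<Rightarrow> ('k, 'v) ly_algebra \<Rightarrow> 'v"  (\<open>\<lbrace>_, _, _\<rbrace>\<^bsub>_\<^esub>\<close>) where
  "\<lbrace>x, y, z\<rbrace>\<^bsub>A\<^esub> \<equiv> triple A x y z"

abbreviation ly_linear
  :: "('k::field, 'a::ab_group_add) ly_algebra \<Rightarrow> ('k, 'b::ab_group_add) ly_algebra
      \<Rightarrow> ('a \<Rightarrow> 'b) \<Rightarrow> bool" where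
  "ly_linear A B \<equiv> Vector_Spaces.linear (smult A) (smult B)"

definition bilinear_map
  :: "('k::field, 'a::ab_group_add) ly_algebra \<Rightarrow> ('k, 'b::ab_group_add) ly_algebra
      \<Rightarrow> ('k, 'c::ab_group_add) ly_algebra \<Rightarrow> ('a \<Rightarrow> 'b \<Rightarrow> 'c) \<Rightarrow> bool" where
  "bilinear_map A B C f \<longleftrightarrow>
     (\<forall>y. ly_linear A C (\<lambda>x. f x y)) \<and> (\<forall>x. ly_linear B C (\<lambda>y. f x y))"

definition trilinear_map
  :: "('k::field, 'a::ab_group_add) ly_algebra \<Rightarrow> ('k, 'b::ab_group_add) ly_algebra
      \<Rightarrow> ('k, 'c::ab_group_add) ly_algebra \<Rightarrow> ('k, 'd::ab_group_add) ly_algebra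
      \<Rightarrow> ('a \<Rightarrow> 'b \<Rightarrow> 'c \<Rightarrow> 'd) \<Rightarrow> bool" where
  "trilinear_map A B C E f \<longleftrightarrow>
     (\<forall>y z. ly_linear A E (\<lambda>x. f x y z)) \<and> (\<forall>x z. ly_linear B E (\<lambda>y. f x y z)) \<and>
     (\<forall>x y. ly_linear C E (\<lambda>z. f x y z))"

locale lie_yamaguti =
  fixes A :: "('k::field, 'v::ab_group_add) ly_algebra"
  assumes vector_space: "vector_space (smult A)"
    and bracket_bilinear: "bilinear_map A A A (bracket A)"
    and triple_trilinear: "trilinear_map A A A A (triple A)"
    and bracket_skew: "[x1, x2]\<^bsub>A\<^esub> + [x2, x1]\<^bsub>A\<^esub> = 0"
    and triple_skew: "\<lbrace>x1, x2, x3\<rbrace>\<^bsub>A\<^esub> + \<lbrace>x2, x1, x3\<rbrace>\<^bsub>A\<^esub> = 0"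
    and jacobi:
      "[[x1, x2]\<^bsub>A\<^esub>, x3]\<^bsub>A\<^esub> + [[x2, x3]\<^bsub>A\<^esub>, x1]\<^bsub>A\<^esub> + [[x3, x1]\<^bsub>A\<^esub>, x2]\<^bsub>A\<^esub>
       + \<lbrace>x1, x2, x3\<rbrace>\<^bsub>A\<^esub> + \<lbrace>x2, x3, x1\<rbrace>\<^bsub>A\<^esub> + \<lbrace>x3, x1, x2\<rbrace>\<^bsub>A\<^esub> = 0"
    and triple_cyclic:
      "\<lbrace>[x1, x2]\<^bsub>A\<^esub>, x3, y1\<rbrace>\<^bsub>A\<^esub> + \<lbrace>[x2, x3]\<^bsub>A\<^esub>, x1, y1\<rbrace>\<^bsub>A\<^esub> + \<lbrace>[x3, x1]\<^bsub>A\<^esub>, x2, y1\<rbrace>\<^bsub>A\<^esub> = 0"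
    and derivation_bracket:
      "\<lbrace>x1, x2, [y1, y2]\<^bsub>A\<^esub>\<rbrace>\<^bsub>A\<^esub> = [\<lbrace>x1, x2, y1\<rbrace>\<^bsub>A\<^esub>, y2]\<^bsub>A\<^esub> + [y1, \<lbrace>x1, x2, y2\<rbrace>\<^bsub>A\<^esub>]\<^bsub>A\<^esub>"
    and derivation_triple:
      "\<lbrace>x1, x2, \<lbrace>y1, y2, y3\<rbrace>\<^bsub>A\<^esub>\<rbrace>\<^bsub>A\<^esub> =
         \<lbrace>\<lbrace>x1, x2, y1\<rbrace>\<^bsub>A\<^esub>, y2, y3\<rbrace>\<^bsub>A\<^esub> + \<lbrace>y1, \<lbrace>x1, x2, y2\<rbrace>\<^bsub>A\<^esub>, y3\<rbrace>\<^bsub>A\<^esub>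
         + \<lbrace>y1, y2, \<lbrace>x1, x2, y3\<rbrace>\<^bsub>A\<^esub>\<rbrace>\<^bsub>A\<^esub>"

definition ly_hom
  :: "('k::field, 'a::ab_group_add) ly_algebra \<Rightarrow> ('k, 'b::ab_group_add) ly_algebra
      \<Rightarrow> ('a \<Rightarrow> 'b) \<Rightarrow> bool" where
  "ly_hom A B f \<longleftrightarrow> ly_linear A B f \<and>
     (\<forall>x y. f [x, y]\<^bsub>A\<^esub> = [f x, f y]\<^bsub>B\<^esub>) \<and>
     (\<forall>x y z. f \<lbrace>x, y, z\<rbrace>\<^bsub>A\<^esub> = \<lbrace>f x, f y, f z\<rbrace>\<^bsub>B\<^esub>)"

definition ly_Aut :: "('k::field, 'a::ab_group_add) ly_algebra \<Rightarrow> ('a \<Rightarrow> 'a) monoid" where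
  "ly_Aut A = \<lparr>carrier = {f. ly_hom A A f \<and> bij f}, mult = (\<circ>), one = id\<rparr>"

definition ly_Aut_stab
  :: "('k::field, 'a::ab_group_add) ly_algebra \<Rightarrow> 'a set \<Rightarrow> ('a \<Rightarrow> 'a) monoid" where
  "ly_Aut_stab A S = (ly_Aut A)\<lparr>carrier := {f \<in> carrier (ly_Aut A). f ` S = S}\<rparr>"


section \<open>Non-abelian extensions and sections\<close>

text \<open>
  The algebra \<open>H\<close> lives on its own type and is identified with its image through the
  injective homomorphism \<open>j\<close>; \<open>the_inv j\<close> translates elements of the image back to \<open>H\<close>.
\<close>

locale ly_extension =
  H: lie_yamaguti H + E: lie_yamaguti E + G: lie_yamaguti G
  for H :: "('k::field, 'h::ab_group_add) ly_algebra"
    and E :: "('k, 'e::ab_group_add) ly_algebra"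
    and G :: "('k, 'g::ab_group_add) ly_algebra"
    and j :: "'h \<Rightarrow> 'e" and p :: "'e \<Rightarrow> 'g" +
  assumes j_hom: "ly_hom H E j"
    and p_hom: "ly_hom E G p"
    and j_inj: "inj j"
    and p_surj: "surj p"
    and exact: "range j = {e. p e = 0}"

definition ly_section
  :: "('k::field, 'e::ab_group_add) ly_algebra \<Rightarrow> ('k, 'g::ab_group_add) ly_algebra
      \<Rightarrow> ('e \<Rightarrow> 'g) \<Rightarrow> ('g \<Rightarrow> 'e) \<Rightarrow> bool" where
  "ly_section E G p s \<longleftrightarrow> ly_linear G E s \<and> (\<forall>x. p (s x) = x)"


section \<open>Non-abelian cocycles\<close>

text \<open>
  A septuple \<open>(\<chi>, \<omega>, \<mu>, \<theta>, D, \<rho>, T)\<close>, all maps being curried. Sums and differences of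
  septuples are componentwise and pointwise.
\<close>

type_synonym ('g, 'h) septuple =
  "('g \<Rightarrow> 'g \<Rightarrow> 'h) \<times> ('g \<Rightarrow> 'g \<Rightarrow> 'g \<Rightarrow> 'h) \<times> ('g \<Rightarrow> 'h \<Rightarrow> 'h) \<times>
   ('g \<Rightarrow> 'g \<Rightarrow> 'h \<Rightarrow> 'h) \<times> ('g \<Rightarrow> 'g \<Rightarrow> 'h \<Rightarrow> 'h) \<times>
   ('g \<Rightarrow> 'h \<Rightarrow> 'h \<Rightarrow> 'h) \<times> ('g \<Rightarrow> 'h \<Rightarrow> 'h \<Rightarrow> 'h)"

locale nab_cocycle =
  fixes G :: "('k::field, 'g::ab_group_add) ly_algebra"
    and H :: "('k, 'h::ab_group_add) ly_algebra"
    and \<chi> :: "'g \<Rightarrow> 'g \<Rightarrow> 'h"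
    and \<omega> :: "'g \<Rightarrow> 'g \<Rightarrow> 'g \<Rightarrow> 'h"
    and \<mu> :: "'g \<Rightarrow> 'h \<Rightarrow> 'h"
    and \<theta> D :: "'g \<Rightarrow> 'g \<Rightarrow> 'h \<Rightarrow> 'h"
    and \<rho> T :: "'g \<Rightarrow> 'h \<Rightarrow> 'h \<Rightarrow> 'h"
  assumes chi_bilinear: "bilinear_map G G H \<chi>"
    and omega_trilinear: "trilinear_map G G G H \<omega>"
    and mu_bilinear: "bilinear_map G H H \<mu>"
    and theta_trilinear: "trilinear_map G G H H \<theta>"
    and D_trilinear: "trilinear_map G G H H D"
    and rho_trilinear: "trilinear_map G H H H \<rho>"
    and T_trilinear: "trilinear_map G H H H T"

    and i1: "\<chi> x y + \<chi> y x = 0"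
    and i2: "\<omega> x y z + \<omega> y x z = 0"
    and i3: "D x y a + D y x a = 0"
    and i4: "T x a b + T x b a = 0"

    and ii1: "\<chi> [x, y]\<^bsub>G\<^esub> z - \<mu> z (\<chi> x y) + \<omega> x y z
        + \<chi> [y, z]\<^bsub>G\<^esub> x - \<mu> x (\<chi> y z) + \<omega> y z x
        + \<chi> [z, x]\<^bsub>G\<^esub> y - \<mu> y (\<chi> z x) + \<omega> z x y = 0"
    and ii2: "\<mu> [x, y]\<^bsub>G\<^esub> a + [\<chi> x y, a]\<^bsub>H\<^esub> + D x y a - \<mu> x (\<mu> y a) - \<theta> y x a
        + \<mu> y (\<mu> x a) + \<theta> x y a = 0"
    and ii3: "[\<mu> x a, b]\<^bsub>H\<^esub> + \<rho> x a b - \<mu> x [a, b]\<^bsub>H\<^esub> + T x a b - [\<mu> x b, a]\<^bsub>H\<^esub> - \<rho> x b a = 0"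

    and iii1: "\<omega> [x, y]\<^bsub>G\<^esub> z w + \<omega> [y, z]\<^bsub>G\<^esub> x w + \<omega> [z, x]\<^bsub>G\<^esub> y w
        + \<theta> z w (\<chi> x y) + \<theta> x w (\<chi> y z) + \<theta> y w (\<chi> z x) = 0"
    and iii2: "D [x, y]\<^bsub>G\<^esub> z a - \<rho> z (\<chi> x y) a + D [y, z]\<^bsub>G\<^esub> x a - \<rho> x (\<chi> y z) a
        + D [z, x]\<^bsub>G\<^esub> y a - \<rho> y (\<chi> z x) a = 0"
    and iii3: "\<theta> [x, y]\<^bsub>G\<^esub> z a - T z (\<chi> x y) a - \<theta> x z (\<mu> y a) + \<theta> y z (\<mu> x a) = 0"
    and iii4: "\<rho> [x, y]\<^bsub>G\<^esub> a b + \<lbrace>\<chi> x y, a, b\<rbrace>\<^bsub>H\<^esub> - \<rho> x (\<mu> y a) b + \<rho> y (\<mu> x a) b = 0"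
    and iii5: "T y (\<mu> x a) b + \<theta> x y [a, b]\<^bsub>H\<^esub> - T y (\<mu> x b) a = 0"
    and iii6: "\<lbrace>\<mu> x a, b, c\<rbrace>\<^bsub>H\<^esub> - \<rho> x [a, b]\<^bsub>H\<^esub> c - \<lbrace>\<mu> x b, a, c\<rbrace>\<^bsub>H\<^esub> = 0"
    and iii7: "T x [a, b]\<^bsub>H\<^esub> c + T x [b, c]\<^bsub>H\<^esub> a + T x [c, a]\<^bsub>H\<^esub> b = 0"

    and iv1: "\<omega> x y [z, w]\<^bsub>G\<^esub> + D x y (\<chi> z w) =
        \<chi> \<lbrace>x, y, z\<rbrace>\<^bsub>G\<^esub> w - \<mu> w (\<omega> x y z) + \<mu> z (\<omega> x y w) + \<chi> z \<lbrace>x, y, w\<rbrace>\<^bsub>G\<^esub>"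
    and iv2: "D x y (\<mu> z a) = \<mu> \<lbrace>x, y, z\<rbrace>\<^bsub>G\<^esub> a + [\<omega> x y z, a]\<^bsub>H\<^esub> + \<mu> z (D x y a)"
    and iv3: "\<theta> x [y, z]\<^bsub>G\<^esub> a - \<rho> x a (\<chi> y z) = \<mu> y (\<theta> x z a) - \<mu> z (\<theta> x y a)"
    and iv4: "D x y [a, b]\<^bsub>H\<^esub> = [D x y a, b]\<^bsub>H\<^esub> + [a, D x y b]\<^bsub>H\<^esub>"
    and iv5: "\<rho> x a (\<mu> y b) + [\<theta> x y a, b]\<^bsub>H\<^esub> - \<mu> y (\<rho> x a b) = 0"
    and iv6: "T [x, y]\<^bsub>G\<^esub> a b + \<lbrace>a, b, \<chi> x y\<rbrace>\<^bsub>H\<^esub> - \<mu> x (T y a b) + \<mu> y (T x a b) = 0"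
    and iv7: "\<lbrace>a, b, \<mu> x c\<rbrace>\<^bsub>H\<^esub> = \<mu> x \<lbrace>a, b, c\<rbrace>\<^bsub>H\<^esub> - [c, T x a b]\<^bsub>H\<^esub>"
    and iv8: "\<rho> x a [b, c]\<^bsub>H\<^esub> = [\<rho> x a b, c]\<^bsub>H\<^esub> + [b, \<rho> x a c]\<^bsub>H\<^esub>"

    and v1: "D x1 x2 (\<omega> y1 y2 y3) + \<omega> x1 x2 \<lbrace>y1, y2, y3\<rbrace>\<^bsub>G\<^esub> =
        \<omega> \<lbrace>x1, x2, y1\<rbrace>\<^bsub>G\<^esub> y2 y3 + \<theta> y2 y3 (\<omega> x1 x2 y1)
        + \<omega> y1 \<lbrace>x1, x2, y2\<rbrace>\<^bsub>G\<^esub> y3 - \<theta> y1 y3 (\<omega> x1 x2 y2)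
        + \<omega> y1 y2 \<lbrace>x1, x2, y3\<rbrace>\<^bsub>G\<^esub> + D y1 y2 (\<omega> x1 x2 y3)"
    and v2: "D x y (\<theta> z w a) - \<theta> z w (D x y a) =
        \<theta> \<lbrace>x, y, z\<rbrace>\<^bsub>G\<^esub> w a + \<theta> z \<lbrace>x, y, w\<rbrace>\<^bsub>G\<^esub> a - T w (\<omega> x y z) a - \<rho> z a (\<omega> x y w)"
    and v3: "\<theta> x \<lbrace>y, z, w\<rbrace>\<^bsub>G\<^esub> a - \<rho> x a (\<omega> y z w) =
        \<theta> z w (\<theta> x y a) - \<theta> y w (\<theta> x z a) + D y z (\<theta> x w a)"
    and v4: "D x y (D z w a) - D z w (D x y a) =
        D \<lbrace>x, y, z\<rbrace>\<^bsub>G\<^esub> w a + D z \<lbrace>x, y, w\<rbrace>\<^bsub>G\<^esub> a - \<rho> w (\<omega> x y z) a + \<rho> z (\<omega> x y w) a"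
    and v5: "D x y (\<rho> z a b) - \<rho> \<lbrace>x, y, z\<rbrace>\<^bsub>G\<^esub> a b =
        \<rho> z (D x y a) b + \<rho> z a (D x y b) + \<lbrace>\<omega> x y z, a, b\<rbrace>\<^bsub>H\<^esub>"
    and v6: "D y z (\<rho> x a b) = \<rho> x a (D y z b) - \<rho> z (\<theta> x y a) b + \<rho> y (\<theta> x z a) b"
    and v7: "\<theta> y z (\<rho> x a b) = \<rho> x a (\<theta> y z b) - T z (\<theta> x y a) b - \<rho> y b (\<theta> x z a)"
    and v8: "D x y (T z a b) - T \<lbrace>x, y, z\<rbrace>\<^bsub>G\<^esub> a b =
        T z (D x y a) b + T z a (D x y b) + \<lbrace>a, b, \<omega> x y z\<rbrace>\<^bsub>H\<^esub>"
    and v9: "T \<lbrace>x, y, z\<rbrace>\<^bsub>G\<^esub> a b - D x y (T z a b) + \<lbrace>a, b, \<omega> x y z\<rbrace>\<^bsub>H\<^esub> =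
        \<theta> y z (T x a b) - \<theta> x z (T y a b)"
    and v10: "D x y \<lbrace>a, b, c\<rbrace>\<^bsub>H\<^esub> =
        \<lbrace>D x y a, b, c\<rbrace>\<^bsub>H\<^esub> + \<lbrace>a, D x y b, c\<rbrace>\<^bsub>H\<^esub> + \<lbrace>a, b, D x y c\<rbrace>\<^bsub>H\<^esub>"
    and v11: "\<rho> x a (\<rho> y b c) = \<rho> y (\<rho> x a b) c + \<rho> y b (\<rho> x a c) - \<lbrace>\<theta> x y a, b, c\<rbrace>\<^bsub>H\<^esub>"
    and v12: "\<lbrace>a, b, \<theta> x y c\<rbrace>\<^bsub>H\<^esub> = \<theta> x y \<lbrace>a, b, c\<rbrace>\<^bsub>H\<^esub> - T y (T x a b) c - \<rho> x c (T y a b)"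
    and v13: "\<rho> x a (T y b c) = T y (\<rho> x a b) c + T y b (\<rho> x a c) - \<lbrace>b, c, \<theta> x y a\<rbrace>\<^bsub>H\<^esub>"
    and v14: "\<lbrace>a, b, D x y c\<rbrace>\<^bsub>H\<^esub> = D x y \<lbrace>a, b, c\<rbrace>\<^bsub>H\<^esub> - \<rho> y (T x a b) c + \<rho> x (T y a b) c"
    and v15: "\<lbrace>a, b, \<rho> x c d\<rbrace>\<^bsub>H\<^esub> = \<rho> x \<lbrace>a, b, c\<rbrace>\<^bsub>H\<^esub> d - \<lbrace>c, T x a b, d\<rbrace>\<^bsub>H\<^esub> + \<rho> x c \<lbrace>a, b, d\<rbrace>\<^bsub>H\<^esub>"
    and v16: "\<rho> x a \<lbrace>b, c, d\<rbrace>\<^bsub>H\<^esub> =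
        \<lbrace>\<rho> x a b, c, d\<rbrace>\<^bsub>H\<^esub> + \<lbrace>b, \<rho> x a c, d\<rbrace>\<^bsub>H\<^esub> + \<lbrace>b, c, \<rho> x a d\<rbrace>\<^bsub>H\<^esub>"
    and v17: "\<lbrace>a, b, T x c d\<rbrace>\<^bsub>H\<^esub> = T x \<lbrace>a, b, c\<rbrace>\<^bsub>H\<^esub> d + T x c \<lbrace>a, b, d\<rbrace>\<^bsub>H\<^esub> + \<lbrace>c, d, T x a b\<rbrace>\<^bsub>H\<^esub>"

definition Z23_nab
  :: "('k::field, 'g::ab_group_add) ly_algebra \<Rightarrow> ('k, 'h::ab_group_add) ly_algebra
      \<Rightarrow> ('g, 'h) septuple set" where
  "Z23_nab G H = {(\<chi>, \<omega>, \<mu>, \<theta>, D, \<rho>, T). nab_cocycle G H \<chi> \<omega> \<mu> \<theta> D \<rho> T}"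

fun nab_equivalent
  :: "('k::field, 'g::ab_group_add) ly_algebra \<Rightarrow> ('k, 'h::ab_group_add) ly_algebra
      \<Rightarrow> ('g, 'h) septuple \<Rightarrow> ('g, 'h) septuple \<Rightarrow> bool" where
  "nab_equivalent G H (\<chi>1, \<omega>1, \<mu>1, \<theta>1, D1, \<rho>1, T1) (\<chi>2, \<omega>2, \<mu>2, \<theta>2, D2, \<rho>2, T2) \<longleftrightarrow>
   (\<exists>\<phi>. ly_linear G H \<phi> \<and>
     (\<forall>x y. \<chi>1 x y - \<chi>2 x y = [\<phi> x, \<phi> y]\<^bsub>H\<^esub> + \<phi> [x, y]\<^bsub>G\<^esub> - \<mu>2 x (\<phi> y) + \<mu>2 y (\<phi> x)) \<and>
     (\<forall>x y z. \<omega>1 x y z - \<omega>2 x y z =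
        \<theta>2 x z (\<phi> y) - D2 x y (\<phi> z) + \<rho>2 x (\<phi> y) (\<phi> z) - \<theta>2 y z (\<phi> x)
        + T2 z (\<phi> x) (\<phi> y) - \<rho>2 y (\<phi> x) (\<phi> z) - \<lbrace>\<phi> x, \<phi> y, \<phi> z\<rbrace>\<^bsub>H\<^esub> + \<phi> \<lbrace>x, y, z\<rbrace>\<^bsub>G\<^esub>) \<and>
     (\<forall>x a. \<mu>1 x a - \<mu>2 x a = [a, \<phi> x]\<^bsub>H\<^esub>) \<and>
     (\<forall>x y a. \<theta>1 x y a - \<theta>2 x y a = \<rho>2 x a (\<phi> y) - T2 y a (\<phi> x) + \<lbrace>a, \<phi> x, \<phi> y\<rbrace>\<^bsub>H\<^esub>) \<and>
     (\<forall>x y a. D1 x y a - D2 x y a = \<rho>2 y (\<phi> x) a - \<rho>2 x (\<phi> y) a + \<lbrace>\<phi> x, \<phi> y, a\<rbrace>\<^bsub>H\<^esub>) \<and>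
     (\<forall>x a b. \<rho>1 x a b - \<rho>2 x a b = \<lbrace>a, \<phi> x, b\<rbrace>\<^bsub>H\<^esub>) \<and>
     (\<forall>x a b. T1 x a b - T2 x a b = \<lbrace>b, a, \<phi> x\<rbrace>\<^bsub>H\<^esub>))"

definition nab_equiv_rel
  :: "('k::field, 'g::ab_group_add) ly_algebra \<Rightarrow> ('k, 'h::ab_group_add) ly_algebra
      \<Rightarrow> ('g, 'h) septuple rel" where
  "nab_equiv_rel G H =
     {(c1, c2). c1 \<in> Z23_nab G H \<and> c2 \<in> Z23_nab G H \<and> nab_equivalent G H c1 c2}"

definition H23_nab
  :: "('k::field, 'g::ab_group_add) ly_algebra \<Rightarrow> ('k, 'h::ab_group_add) ly_algebra
      \<Rightarrow> ('g, 'h) septuple set set" where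
  "H23_nab G H = Z23_nab G H // nab_equiv_rel G H"

fun nab_1cocycle
  :: "('k::field, 'g::ab_group_add) ly_algebra \<Rightarrow> ('k, 'h::ab_group_add) ly_algebra
      \<Rightarrow> ('g, 'h) septuple \<Rightarrow> ('g \<Rightarrow> 'h) \<Rightarrow> bool" where
  "nab_1cocycle G H (\<chi>, \<omega>, \<mu>, \<theta>, D, \<rho>, T) \<phi> \<longleftrightarrow>
     ly_linear G H \<phi> \<and>
     (\<forall>x a. [a, \<phi> x]\<^bsub>H\<^esub> = 0) \<and>
     (\<forall>x a b. \<lbrace>a, b, \<phi> x\<rbrace>\<^bsub>H\<^esub> = 0) \<and>
     (\<forall>x a b. \<lbrace>\<phi> x, a, b\<rbrace>\<^bsub>H\<^esub> = 0) \<and>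
     (\<forall>x y a. \<lbrace>\<phi> x, \<phi> y, a\<rbrace>\<^bsub>H\<^esub> - \<rho> x (\<phi> y) a + \<rho> y (\<phi> x) a = 0) \<and>
     (\<forall>x y a. \<lbrace>a, \<phi> x, \<phi> y\<rbrace>\<^bsub>H\<^esub> - T y a (\<phi> x) + \<rho> x a (\<phi> y) = 0) \<and>
     (\<forall>x y. \<mu> x (\<phi> y) - \<mu> y (\<phi> x) = \<phi> [x, y]\<^bsub>G\<^esub> + [\<phi> x, \<phi> y]\<^bsub>H\<^esub>) \<and>
     (\<forall>x y z. T z (\<phi> x) (\<phi> y) - \<rho> y (\<phi> x) (\<phi> z) - \<theta> y z (\<phi> x) + \<rho> x (\<phi> y) (\<phi> z)
        + \<theta> x z (\<phi> y) - D x y (\<phi> z) = \<lbrace>\<phi> x, \<phi> y, \<phi> z\<rbrace>\<^bsub>H\<^esub> - \<phi> \<lbrace>x, y, z\<rbrace>\<^bsub>G\<^esub>)"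

definition Z1_nab
  :: "('k::field, 'g::ab_group_add) ly_algebra \<Rightarrow> ('k, 'h::ab_group_add) ly_algebra
      \<Rightarrow> ('g, 'h) septuple \<Rightarrow> ('g \<Rightarrow> 'h) monoid" where
  "Z1_nab G H c =
     \<lparr>carrier = {\<phi>. nab_1cocycle G H c \<phi>}, mult = (\<lambda>\<phi> \<psi> x. \<phi> x + \<psi> x), one = (\<lambda>x. 0)\<rparr>"

definition induced_cocycle
  :: "('k::field, 'e::ab_group_add) ly_algebra \<Rightarrow> ('k, 'g::ab_group_add) ly_algebra
      \<Rightarrow> ('h::ab_group_add \<Rightarrow> 'e) \<Rightarrow> ('g \<Rightarrow> 'e) \<Rightarrow> ('g, 'h) septuple" where
  "induced_cocycle E G j s =
    (\<lambda>x y. the_inv j ([s x, s y]\<^bsub>E\<^esub> - s [x, y]\<^bsub>G\<^esub>),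
     \<lambda>x y z. the_inv j (\<lbrace>s x, s y, s z\<rbrace>\<^bsub>E\<^esub> - s \<lbrace>x, y, z\<rbrace>\<^bsub>G\<^esub>),
     \<lambda>x a. the_inv j [s x, j a]\<^bsub>E\<^esub>,
     \<lambda>x y a. the_inv j \<lbrace>j a, s x, s y\<rbrace>\<^bsub>E\<^esub>,
     \<lambda>x y a. the_inv j \<lbrace>s x, s y, j a\<rbrace>\<^bsub>E\<^esub>,
     \<lambda>x a b. the_inv j \<lbrace>s x, j a, j b\<rbrace>\<^bsub>E\<^esub>,
     \<lambda>x a b. the_inv j \<lbrace>j a, j b, s x\<rbrace>\<^bsub>E\<^esub>)"


section \<open>The maps of the Wells sequence\<close>

text \<open>
  Every \<open>e\<close> is \<open>j a + s x\<close> for exactly one pair, namely \<open>x = p e\<close> and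
  \<open>a = the_inv j (e - s (p e))\<close>.
\<close>

definition wells_i
  :: "('h::ab_group_add \<Rightarrow> 'e::ab_group_add) \<Rightarrow> ('e \<Rightarrow> 'g) \<Rightarrow> ('g \<Rightarrow> 'e)
      \<Rightarrow> ('g \<Rightarrow> 'h) \<Rightarrow> 'e \<Rightarrow> 'e" where
  "wells_i j p s \<phi> e =
     (let x = p e; a = the_inv j (e - s (p e)) in j a + s x - j (\<phi> x))"

definition wells_K
  :: "('h \<Rightarrow> 'e) \<Rightarrow> ('e \<Rightarrow> 'g) \<Rightarrow> ('g \<Rightarrow> 'e) \<Rightarrow> ('e \<Rightarrow> 'e) \<Rightarrow> ('g \<Rightarrow> 'g) \<times> ('h \<Rightarrow> 'h)" where
  "wells_K j p s \<gamma> = (p \<circ> \<gamma> \<circ> s, the_inv j \<circ> \<gamma> \<circ> j)"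

fun twist
  :: "('g \<Rightarrow> 'g) \<times> ('h \<Rightarrow> 'h) \<Rightarrow> ('g, 'h) septuple \<Rightarrow> ('g, 'h) septuple" where
  "twist (\<alpha>, \<beta>) (\<chi>, \<omega>, \<mu>, \<theta>, D, \<rho>, T) =
    (let \<alpha>' = the_inv \<alpha>; \<beta>' = the_inv \<beta> in
     (\<lambda>x y. \<beta> (\<chi> (\<alpha>' x) (\<alpha>' y)),
      \<lambda>x y z. \<beta> (\<omega> (\<alpha>' x) (\<alpha>' y) (\<alpha>' z)),
      \<lambda>x a. \<beta> (\<mu> (\<alpha>' x) (\<beta>' a)),
      \<lambda>x y a. \<beta> (\<theta> (\<alpha>' x) (\<alpha>' y) (\<beta>' a)),
      \<lambda>x y a. \<beta> (D (\<alpha>' x) (\<alpha>' y) (\<beta>' a)),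
      \<lambda>x a b. \<beta> (\<rho> (\<alpha>' x) (\<beta>' a) (\<beta>' b)),
      \<lambda>x a b. \<beta> (T (\<alpha>' x) (\<beta>' a) (\<beta>' b))))"

text \<open>
  The difference \<open>\<delta>\<close> of two non-abelian cocycles is in general not a cocycle, so it has no
  class in \<open>H23_nab\<close> by itself. The class of a difference \<open>\<delta>\<close> from a fixed cocycle \<open>c\<close> is
  therefore taken with \<open>c\<close> as the origin: it is the class of \<open>c + \<delta>\<close>. With this convention
  \<open>diff_class G H c 0\<close>, the class of \<open>c\<close>, is the base point of \<open>H23_nab\<close>.
\<close>

definition diff_class
  :: "('k::field, 'g::ab_group_add) ly_algebra \<Rightarrow> ('k, 'h::ab_group_add) ly_algebra
      \<Rightarrow> ('g, 'h) septuple \<Rightarrow> ('g, 'h) septuple \<Rightarrow> ('g, 'h) septuple set" where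
  "diff_class G H c \<delta> = nab_equiv_rel G H `` {c + \<delta>}"

definition wells_map
  :: "('k::field, 'g::ab_group_add) ly_algebra \<Rightarrow> ('k, 'h::ab_group_add) ly_algebra
      \<Rightarrow> ('g, 'h) septuple \<Rightarrow> ('g \<Rightarrow> 'g) \<times> ('h \<Rightarrow> 'h) \<Rightarrow> ('g, 'h) septuple set" where
  "wells_map G H c \<alpha>\<beta> = diff_class G H c (twist \<alpha>\<beta> c - c)"

definition wells_kernel
  :: "('k::field, 'g::ab_group_add) ly_algebra \<Rightarrow> ('k, 'h::ab_group_add) ly_algebra
      \<Rightarrow> ('g, 'h) septuple \<Rightarrow> (('g \<Rightarrow> 'g) \<times> ('h \<Rightarrow> 'h)) set" where
  "wells_kernel G H c =
     {\<alpha>\<beta> \<in> carrier (ly_Aut G \<times>\<times> ly_Aut H). nab_equivalent G H (twist \<alpha>\<beta> c) c}"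

end

theory Submission
  imports Defs
begin

text \<open>
  Write \<open>c\<close> for the cocycle induced by the section \<open>s\<close>. Three facts carry the proof.

  First, an equivalence of septuples is an action in disguise. The defining equations of
  equivalence say \<open>c1 = shift G H \<phi> c2\<close> for a linear \<open>\<phi>\<close>, where \<open>shift\<close> obeys the laws of
  an action of the additive group of linear maps \<open>G \<rightarrow> H\<close> at every cocycle (\<open>shift_0\<close>,
  \<open>shift_shift\<close>). Hence
  equivalence is an equivalence relation, and the group of non-abelian 1-cocycles is the
  stabiliser of \<open>c\<close> (\<open>nab_1cocycle_iff_shift\<close>); in particular it is closed under addition
  in every characteristic.

  Secondly, both operations on \<open>c\<close> come from changing the data of the extension:
  \<open>shift G H \<phi> c\<close> is induced by the section \<open>s - j \<circ> \<phi>\<close>, every section has this form, and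
  \<open>twist (\<alpha>, \<beta>) c\<close> is induced by the section \<open>s \<circ> \<alpha>\<inverse>\<close> of the extension with inclusion
  \<open>j \<circ> \<beta>\<inverse>\<close> and projection \<open>\<alpha> \<circ> p\<close>. As the cocycle of any extension satisfies the cocycle
  identities, so does the twisted one.

  Thirdly, a linear map between two extensions of \<open>G\<close> by \<open>H\<close> that respects the inclusions and
  the sections is a homomorphism iff the two induced cocycles are equal
  (\<open>hom_iff_induced_cocycle_eq\<close>).

  For the inclusion \<open>j\<close> and the sections \<open>s\<close> and \<open>s - j \<circ> \<phi>\<close>, the third fact says that \<open>i \<phi>\<close>
  is an automorphism iff \<open>\<phi>\<close> stabilises \<open>c\<close>. An automorphism \<open>\<gamma>\<close> with trivial image under \<open>K\<close> fixes
  \<open>H\<close> and turns \<open>s\<close> into another section of \<open>p\<close>, so it is \<open>i \<phi>\<close> for some such \<open>\<phi>\<close>; this is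
  exactness at \<open>ly_Aut_stab E (range j)\<close>. For the twisted extension and the extension with
  section \<open>s - j \<circ> \<phi>\<close>, the third fact says that \<open>(\<alpha>, \<beta>)\<close> lifts to an automorphism \<open>\<gamma>\<close> with
  \<open>\<gamma> \<circ> s \<circ> \<alpha>\<inverse> = s - j \<circ> \<phi>\<close> iff \<open>twist (\<alpha>, \<beta>) c = shift G H \<phi> c\<close>, which is exactness at
  \<open>ly_Aut G \<times>\<times> ly_Aut H\<close>.
\<close>

section \<open>Multilinear maps\<close>

lemma ly_linear_iff:
  fixes A :: "('k::field, 'a::ab_group_add) ly_algebra"
    and B :: "('k, 'b::ab_group_add) ly_algebra"
  assumes "vector_space (smult A)" "vector_space (smult B)"
  shows "ly_linear A B f \<longleftrightarrow>
    (\<forall>x y. f (x + y) = f x + f y) \<and> (\<forall>k x. f (smult A k x) = smult B k (f x))"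
proof -
  interpret vector_space_pair "smult A" "smult B"
    using assms by (simp add: vector_space_pair_def)
  show ?thesis using assms by (simp add: linear_iff)
qed

lemma ly_linear_rules:
  fixes A :: "('k::field, 'a::ab_group_add) ly_algebra"
    and B :: "('k, 'b::ab_group_add) ly_algebra"
  assumes "ly_linear A B f"
  shows "f (x + y) = f x + f y" "f (x - y) = f x - f y" "f (- x) = - f x" "f 0 = 0"
    "f (smult A k x) = smult B k (f x)"
proof -
  interpret linear "smult A" "smult B" f by fact
  show "f (x + y) = f x + f y" "f (x - y) = f x - f y" "f (- x) = - f x" "f 0 = 0"
    "f (smult A k x) = smult B k (f x)"
    by (rule add diff neg zero scale)+
qed

lemma bilinear_map_rules:
  fixes A :: "('k::field, 'a::ab_group_add) ly_algebra"
    and B :: "('k, 'b::ab_group_add) ly_algebra"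
    and C :: "('k, 'c::ab_group_add) ly_algebra"
  assumes "bilinear_map A B C f"
  shows "f (x + x') y = f x y + f x' y" "f (x - x') y = f x y - f x' y"
    "f (- x) y = - f x y" "f 0 y = 0" "f (smult A k x) y = smult C k (f x y)"
    "f x (y + y') = f x y + f x y'" "f x (y - y') = f x y - f x y'"
    "f x (- y) = - f x y" "f x 0 = 0" "f x (smult B k y) = smult C k (f x y)"
proof -
  have l: "ly_linear A C (\<lambda>x. f x y)" for y
    using assms by (simp add: bilinear_map_def)
  have r: "ly_linear B C (f x)" for x
    using assms by (simp add: bilinear_map_def)
  show "f (x + x') y = f x y + f x' y" "f (x - x') y = f x y - f x' y"
    "f (- x) y = - f x y" "f 0 y = 0" "f (smult A k x) y = smult C k (f x y)"
    by (rule ly_linear_rules[OF l])+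
  show "f x (y + y') = f x y + f x y'" "f x (y - y') = f x y - f x y'"
    "f x (- y) = - f x y" "f x 0 = 0" "f x (smult B k y) = smult C k (f x y)"
    by (rule ly_linear_rules[OF r])+
qed

lemma trilinear_map_rules:
  fixes A :: "('k::field, 'a::ab_group_add) ly_algebra"
    and B :: "('k, 'b::ab_group_add) ly_algebra"
    and C :: "('k, 'c::ab_group_add) ly_algebra"
    and E :: "('k, 'd::ab_group_add) ly_algebra"
  assumes "trilinear_map A B C E f"
  shows "f (x + x') y z = f x y z + f x' y z" "f (x - x') y z = f x y z - f x' y z"
    "f (- x) y z = - f x y z" "f 0 y z = 0" "f (smult A k x) y z = smult E k (f x y z)"
    "f x (y + y') z = f x y z + f x y' z" "f x (y - y') z = f x y z - f x y' z"
    "f x (- y) z = - f x y z" "f x 0 z = 0" "f x (smult B k y) z = smult E k (f x y z)"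
    "f x y (z + z') = f x y z + f x y z'" "f x y (z - z') = f x y z - f x y z'"
    "f x y (- z) = - f x y z" "f x y 0 = 0" "f x y (smult C k z) = smult E k (f x y z)"
proof -
  have 1: "ly_linear A E (\<lambda>x. f x y z)" for y z
    using assms by (simp add: trilinear_map_def)
  have 2: "ly_linear B E (\<lambda>y. f x y z)" for x z
    using assms by (simp add: trilinear_map_def)
  have 3: "ly_linear C E (f x y)" for x y
    using assms by (simp add: trilinear_map_def)
  show "f (x + x') y z = f x y z + f x' y z" "f (x - x') y z = f x y z - f x' y z"
    "f (- x) y z = - f x y z" "f 0 y z = 0" "f (smult A k x) y z = smult E k (f x y z)"
    by (rule ly_linear_rules[OF 1])+
  show "f x (y + y') z = f x y z + f x y' z" "f x (y - y') z = f x y z - f x y' z"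
    "f x (- y) z = - f x y z" "f x 0 z = 0" "f x (smult B k y) z = smult E k (f x y z)"
    by (rule ly_linear_rules[OF 2])+
  show "f x y (z + z') = f x y z + f x y z'" "f x y (z - z') = f x y z - f x y z'"
    "f x y (- z) = - f x y z" "f x y 0 = 0" "f x y (smult C k z) = smult E k (f x y z)"
    by (rule ly_linear_rules[OF 3])+
qed

context lie_yamaguti
begin

lemmas bracket_rules = bilinear_map_rules[OF bracket_bilinear]
lemmas triple_rules = trilinear_map_rules[OF triple_trilinear]

lemma bracket_swap: "[x, y]\<^bsub>A\<^esub> = - [y, x]\<^bsub>A\<^esub>"
  using bracket_skew[of x y] by (simp add: eq_neg_iff_add_eq_0)

lemma triple_swap: "\<lbrace>x, y, z\<rbrace>\<^bsub>A\<^esub> = - \<lbrace>y, x, z\<rbrace>\<^bsub>A\<^esub>"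
  using triple_skew[of x y z] by (simp add: eq_neg_iff_add_eq_0)

end

section \<open>Automorphism groups\<close>

lemma ly_hom_comp: "ly_hom A B f \<Longrightarrow> ly_hom B C g \<Longrightarrow> ly_hom A C (g \<circ> f)"
  by (auto simp: ly_hom_def intro: Vector_Spaces.linear_compose)

lemma ly_hom_rules:
  assumes "ly_hom A B f"
  shows "f [x, y]\<^bsub>A\<^esub> = [f x, f y]\<^bsub>B\<^esub>" "f \<lbrace>x, y, z\<rbrace>\<^bsub>A\<^esub> = \<lbrace>f x, f y, f z\<rbrace>\<^bsub>B\<^esub>"
    "f (x + y) = f x + f y" "f (x - y) = f x - f y" "f (- x) = - f x" "f 0 = 0"
    "f (smult A k x) = smult B k (f x)"
proof -
  have f: "ly_linear A B f" using assms by (simp add: ly_hom_def)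
  show "f [x, y]\<^bsub>A\<^esub> = [f x, f y]\<^bsub>B\<^esub>" "f \<lbrace>x, y, z\<rbrace>\<^bsub>A\<^esub> = \<lbrace>f x, f y, f z\<rbrace>\<^bsub>B\<^esub>"
    using assms by (simp_all add: ly_hom_def)
  show "f (x + y) = f x + f y" "f (x - y) = f x - f y" "f (- x) = - f x" "f 0 = 0"
    "f (smult A k x) = smult B k (f x)"
    by (rule ly_linear_rules[OF f])+
qed

lemma ly_homI:
  assumes "vector_space (smult A)" "vector_space (smult B)"
    "\<And>x y. f (x + y) = f x + f y" "\<And>k x. f (smult A k x) = smult B k (f x)"
    "\<And>x y. f [x, y]\<^bsub>A\<^esub> = [f x, f y]\<^bsub>B\<^esub>"
    "\<And>x y z. f \<lbrace>x, y, z\<rbrace>\<^bsub>A\<^esub> = \<lbrace>f x, f y, f z\<rbrace>\<^bsub>B\<^esub>"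
  shows "ly_hom A B f"
  using assms by (simp add: ly_hom_def ly_linear_iff)

lemma ly_hom_the_inv:
  assumes "lie_yamaguti A" "ly_hom A A f" "bij f"
  shows "ly_hom A A (the_inv f)" "bij (the_inv f)" "f (the_inv f x) = x" "the_inv f (f x) = x"
proof -
  have inj: "inj f" and surj: "surj f" using assms(3) by (auto simp: bij_def)
  have r: "f (the_inv f x) = x" for x using inj surj by (simp add: f_the_inv_into_f)
  have l: "the_inv f (f x) = x" for x using inj by (simp add: the_inv_f_f)
  show "f (the_inv f x) = x" "the_inv f (f x) = x" by (fact r, fact l)
  show "bij (the_inv f)" using l r by (intro o_bij[of f]) auto
  have eq: "the_inv f y = x" if "f x = y" for x y using l that by blast
  show "ly_hom A A (the_inv f)"
    by (rule ly_homI)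
      (auto intro!: eq simp: ly_hom_rules[OF assms(2)] r lie_yamaguti.vector_space[OF assms(1)])
qed

lemma group_ly_Aut:
  assumes "lie_yamaguti A" shows "group (ly_Aut A)"
proof (rule groupI)
  interpret lie_yamaguti A by fact
  show "\<one>\<^bsub>ly_Aut A\<^esub> \<in> carrier (ly_Aut A)"
    by (auto simp: ly_Aut_def intro: ly_homI vector_space)
  fix f assume "f \<in> carrier (ly_Aut A)"
  then show "\<exists>g\<in>carrier (ly_Aut A). g \<otimes>\<^bsub>ly_Aut A\<^esub> f = \<one>\<^bsub>ly_Aut A\<^esub>"
    using ly_hom_the_inv[OF assms, of f]
    by (intro bexI[of _ "the_inv f"]) (auto simp: ly_Aut_def)
qed (auto simp: ly_Aut_def ly_hom_comp bij_comp o_assoc)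

lemma group_ly_Aut_stab:
  assumes "lie_yamaguti A" shows "group (ly_Aut_stab A S)"
  unfolding ly_Aut_stab_def
proof (rule subgroup.subgroup_is_group[OF group.subgroupI])
  show grp: "group (ly_Aut A)" "group (ly_Aut A)" by (rule group_ly_Aut[OF assms])+
  let ?S = "{f \<in> carrier (ly_Aut A). f ` S = S}"
  have "\<one>\<^bsub>ly_Aut A\<^esub> \<in> ?S"
    using group.is_monoid[OF grp(1), THEN monoid.one_closed] by (simp add: ly_Aut_def)
  then show "?S \<noteq> {}" by blast
  fix f assume f: "f \<in> ?S"
  have inv: "inv\<^bsub>ly_Aut A\<^esub> f \<in> carrier (ly_Aut A)"
    using f group.inv_closed[OF grp(1)] by blast
  have "inv\<^bsub>ly_Aut A\<^esub> f \<circ> f = id"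
    using f group.l_inv[OF grp(1), of f] by (simp add: ly_Aut_def)
  then have "(inv\<^bsub>ly_Aut A\<^esub> f) ` f ` S = S" by (simp add: image_comp)
  then show "inv\<^bsub>ly_Aut A\<^esub> f \<in> ?S" using f inv by simp
  fix g assume g: "g \<in> ?S"
  have "f \<otimes>\<^bsub>ly_Aut A\<^esub> g \<in> carrier (ly_Aut A)"
    using f g group.is_monoid[OF grp(1), THEN monoid.m_closed] by blast
  moreover have "(f \<otimes>\<^bsub>ly_Aut A\<^esub> g) ` S = f ` g ` S" by (simp add: ly_Aut_def image_comp)
  ultimately show "f \<otimes>\<^bsub>ly_Aut A\<^esub> g \<in> ?S" using f g by simp
qed auto

section \<open>Linear maps acting on septuples\<close>

text \<open>
  The septuple \<open>shift G H \<phi> c\<close> is the unique one that is equivalent to \<open>c\<close> through \<open>\<phi>\<close>: the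
  equations of \<open>nab_equivalent\<close> express the components of its first argument by those of its
  second argument and \<open>\<phi>\<close>.
\<close>

fun shift
  :: "('k::field, 'g::ab_group_add) ly_algebra \<Rightarrow> ('k, 'h::ab_group_add) ly_algebra
      \<Rightarrow> ('g \<Rightarrow> 'h) \<Rightarrow> ('g, 'h) septuple \<Rightarrow> ('g, 'h) septuple" where
  "shift G H \<phi> (\<chi>, \<omega>, \<mu>, \<theta>, D, \<rho>, T) =
    (\<lambda>x y. \<chi> x y + ([\<phi> x, \<phi> y]\<^bsub>H\<^esub> + \<phi> [x, y]\<^bsub>G\<^esub> - \<mu> x (\<phi> y) + \<mu> y (\<phi> x)),
     \<lambda>x y z. \<omega> x y z +
       (\<theta> x z (\<phi> y) - D x y (\<phi> z) + \<rho> x (\<phi> y) (\<phi> z) - \<theta> y z (\<phi> x)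
        + T z (\<phi> x) (\<phi> y) - \<rho> y (\<phi> x) (\<phi> z) - \<lbrace>\<phi> x, \<phi> y, \<phi> z\<rbrace>\<^bsub>H\<^esub> + \<phi> \<lbrace>x, y, z\<rbrace>\<^bsub>G\<^esub>),
     \<lambda>x a. \<mu> x a + [a, \<phi> x]\<^bsub>H\<^esub>,
     \<lambda>x y a. \<theta> x y a + (\<rho> x a (\<phi> y) - T y a (\<phi> x) + \<lbrace>a, \<phi> x, \<phi> y\<rbrace>\<^bsub>H\<^esub>),
     \<lambda>x y a. D x y a + (\<rho> y (\<phi> x) a - \<rho> x (\<phi> y) a + \<lbrace>\<phi> x, \<phi> y, a\<rbrace>\<^bsub>H\<^esub>),
     \<lambda>x a b. \<rho> x a b + \<lbrace>a, \<phi> x, b\<rbrace>\<^bsub>H\<^esub>,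
     \<lambda>x a b. T x a b + \<lbrace>b, a, \<phi> x\<rbrace>\<^bsub>H\<^esub>)"

lemma nab_equivalent_iff_shift:
  fixes G :: "('k::field, 'g::ab_group_add) ly_algebra" and H :: "('k, 'h::ab_group_add) ly_algebra"
  shows "nab_equivalent G H c1 c2 \<longleftrightarrow> (\<exists>\<phi>. ly_linear G H \<phi> \<and> c1 = shift G H \<phi> c2)"
proof -
  have *: "a - b = d \<longleftrightarrow> a = b + d" for a b d :: 'h
    by (auto simp: algebra_simps)
  obtain \<chi>1 \<omega>1 \<mu>1 \<theta>1 D1 \<rho>1 T1 where 1: "c1 = (\<chi>1, \<omega>1, \<mu>1, \<theta>1, D1, \<rho>1, T1)" by (cases c1)
  obtain \<chi>2 \<omega>2 \<mu>2 \<theta>2 D2 \<rho>2 T2 where 2: "c2 = (\<chi>2, \<omega>2, \<mu>2, \<theta>2, D2, \<rho>2, T2)" by (cases c2)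
  show ?thesis unfolding 1 2 nab_equivalent.simps shift.simps prod.inject fun_eq_iff *
    by blast
qed

text \<open>
  The equations of a non-abelian 1-cocycle are the equations of a self-equivalence of \<open>c\<close>, up
  to reordering and skew-symmetry of the triple product of \<open>H\<close>.
\<close>

lemma nab_1cocycle_iff_shift:
  fixes G :: "('k::field, 'g::ab_group_add) ly_algebra" and H :: "('k, 'h::ab_group_add) ly_algebra"
  assumes "lie_yamaguti H"
  shows "nab_1cocycle G H c \<phi> \<longleftrightarrow> ly_linear G H \<phi> \<and> shift G H \<phi> c = c"
proof -
  interpret H: lie_yamaguti H by fact
  obtain \<chi> \<omega> \<mu> \<theta> D \<rho> T where c: "c = (\<chi>, \<omega>, \<mu>, \<theta>, D, \<rho>, T)" by (cases c)
  have sw: "\<lbrace>a, \<phi> x, b\<rbrace>\<^bsub>H\<^esub> = 0 \<longleftrightarrow> \<lbrace>\<phi> x, a, b\<rbrace>\<^bsub>H\<^esub> = 0" for a b x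
    using H.triple_swap[of a "\<phi> x" b] by simp
  have e1: "u - v = w + z \<longleftrightarrow> z + w - u + v = 0" for u v w z :: 'h
    by (auto simp: algebra_simps)
  have e2: "t - r2 - th + r1 + th' - d = u - v \<longleftrightarrow> th' - d + r1 - th + t - r2 - u + v = 0"
    for t r2 th r1 th' d u v :: 'h
    by (auto simp: algebra_simps)
  have e3: "u - v + w = 0 \<longleftrightarrow> w - v + u = 0" for u v w :: 'h
    by (auto simp: algebra_simps)
  have z: "a + b = a \<longleftrightarrow> b = 0" for a b :: 'h by simp
  show ?thesis
    unfolding c nab_1cocycle.simps shift.simps prod.inject fun_eq_iff z sw e1 e2
    by (subst e3, subst (2) e3) blast
qed

lemma ly_linear_0:
  assumes "lie_yamaguti G" "lie_yamaguti H" shows "ly_linear G H (\<lambda>_. 0)"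
proof -
  interpret G: lie_yamaguti G by fact
  interpret H: lie_yamaguti H by fact
  interpret H: vector_space "smult H" by (rule H.vector_space)
  show ?thesis by (simp add: ly_linear_iff G.vector_space H.vector_space)
qed

lemma ly_linear_add:
  assumes "ly_linear G H f" "ly_linear G H g" shows "ly_linear G H (\<lambda>x. f x + g x)"
proof -
  interpret f: linear "smult G" "smult H" f by fact
  interpret vector_space_pair "smult G" "smult H" by unfold_locales
  show ?thesis by (rule linear_compose_add) fact+
qed

lemma ly_linear_neg:
  assumes "ly_linear G H f" shows "ly_linear G H (\<lambda>x. - f x)"
proof -
  interpret f: linear "smult G" "smult H" f by fact
  interpret vector_space_pair "smult G" "smult H" by unfold_locales
  show ?thesis by (rule linear_compose_neg) fact
qed

lemma Z23_nabE:
  assumes "c \<in> Z23_nab G H"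
  obtains \<chi> \<omega> \<mu> \<theta> D \<rho> T where "c = (\<chi>, \<omega>, \<mu>, \<theta>, D, \<rho>, T)" "nab_cocycle G H \<chi> \<omega> \<mu> \<theta> D \<rho> T"
  using assms by (auto simp: Z23_nab_def)

lemma shift_0:
  assumes "lie_yamaguti H" "c \<in> Z23_nab G H"
  shows "shift G H (\<lambda>_. 0) c = c"
proof -
  interpret H: lie_yamaguti H by fact
  from assms(2) show ?thesis
  proof (cases rule: Z23_nabE)
    case (1 \<chi> \<omega> \<mu> \<theta> D \<rho> T)
    interpret nab_cocycle G H \<chi> \<omega> \<mu> \<theta> D \<rho> T by fact
    show ?thesis unfolding 1
      by (simp add: H.bracket_rules H.triple_rules bilinear_map_rules[OF mu_bilinear]
          trilinear_map_rules[OF theta_trilinear] trilinear_map_rules[OF D_trilinear]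
          trilinear_map_rules[OF rho_trilinear] trilinear_map_rules[OF T_trilinear])
  qed
qed

text \<open>
  Some components of \<open>shift\<close> are quadratic or cubic in \<open>\<phi>\<close>, so additivity is not automatic: the
  mixed terms in \<open>\<phi>\<close> and \<open>\<psi>\<close> agree because the bracket, the triple product of \<open>H\<close> (in its first two
  arguments) and the maps \<open>T x\<close> are skew-symmetric.
\<close>

lemma shift_shift:
  assumes "lie_yamaguti H" "c \<in> Z23_nab G H"
  shows "shift G H \<phi> (shift G H \<psi> c) = shift G H (\<lambda>x. \<phi> x + \<psi> x) c"
proof -
  interpret H: lie_yamaguti H by fact
  from assms(2) show ?thesis
  proof (cases rule: Z23_nabE)
    case (1 \<chi> \<omega> \<mu> \<theta> D \<rho> T)
    interpret nab_cocycle G H \<chi> \<omega> \<mu> \<theta> D \<rho> T by fact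
    have T_swap: "T x a b = - T x b a" for x a b
      using i4[of x a b] by (simp add: eq_neg_iff_add_eq_0)
    note rules = H.bracket_rules H.triple_rules bilinear_map_rules[OF mu_bilinear]
          trilinear_map_rules[OF theta_trilinear] trilinear_map_rules[OF D_trilinear]
          trilinear_map_rules[OF rho_trilinear] trilinear_map_rules[OF T_trilinear]
    show ?thesis unfolding 1 shift.simps prod.inject fun_eq_iff
      apply (intro conjI allI)
      subgoal for x y
        using H.bracket_swap[of "\<phi> y" "\<psi> x"] by (simp add: rules algebra_simps)
      subgoal for x y z
        using T_swap[of z "\<psi> x" "\<phi> y"] H.triple_swap[of "\<phi> y" "\<psi> x"] H.triple_swap[of "\<phi> x" "\<psi> y"]
           H.triple_swap[of "\<psi> x" "\<psi> y"] H.triple_swap[of "\<phi> y" "\<phi> x"]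
        by (simp add: rules algebra_simps)
      subgoal for x a
        by (simp add: rules algebra_simps)
      subgoal for x y a
        using T_swap[of y a "\<phi> x"] H.triple_swap[of "\<phi> x" a]
        by (simp add: rules algebra_simps)
      subgoal for x y a
        using H.triple_swap[of "\<phi> y" "\<psi> x"] by (simp add: rules algebra_simps)
      subgoal for x a b
        by (simp add: rules algebra_simps)
      subgoal for x a b
        by (simp add: rules algebra_simps)
      done
  qed
qed


lemma equiv_nab_equiv_rel:
  assumes "lie_yamaguti G" "lie_yamaguti H"
  shows "equiv (Z23_nab G H) (nab_equiv_rel G H)"
proof (rule equivI)
  show "nab_equiv_rel G H \<subseteq> Z23_nab G H \<times> Z23_nab G H"
    by (auto simp: nab_equiv_rel_def)
  show "refl_on (Z23_nab G H) (nab_equiv_rel G H)"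
    using ly_linear_0[OF assms] shift_0[OF assms(2)]
    by (fastforce simp: refl_on_def nab_equiv_rel_def nab_equivalent_iff_shift)
  show "sym (nab_equiv_rel G H)"
  proof (rule symI)
    fix c1 c2 assume "(c1, c2) \<in> nab_equiv_rel G H"
    then obtain \<phi> where *: "c1 \<in> Z23_nab G H" "c2 \<in> Z23_nab G H" "ly_linear G H \<phi>"
      "c1 = shift G H \<phi> c2"
      by (auto simp: nab_equiv_rel_def nab_equivalent_iff_shift)
    have "c2 = shift G H (\<lambda>x. - \<phi> x) c1"
      using shift_shift[OF assms(2) *(2), of "\<lambda>x. - \<phi> x" \<phi>] shift_0[OF assms(2) *(2)] *(4)
      by simp
    then show "(c2, c1) \<in> nab_equiv_rel G H"
      using * ly_linear_neg[OF *(3)] unfolding nab_equiv_rel_def nab_equivalent_iff_shift by blast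
  qed
  show "trans (nab_equiv_rel G H)"
  proof (rule transI)
    fix c1 c2 c3 assume "(c1, c2) \<in> nab_equiv_rel G H" "(c2, c3) \<in> nab_equiv_rel G H"
    then obtain \<phi> \<psi> where *: "c1 \<in> Z23_nab G H" "c3 \<in> Z23_nab G H" "ly_linear G H \<phi>"
      "ly_linear G H \<psi>" "c1 = shift G H \<phi> (shift G H \<psi> c3)"
      by (auto simp: nab_equiv_rel_def nab_equivalent_iff_shift)
    then show "(c1, c3) \<in> nab_equiv_rel G H"
      using ly_linear_add[OF *(3,4)] shift_shift[OF assms(2) *(2), of \<phi> \<psi>]
      unfolding nab_equiv_rel_def nab_equivalent_iff_shift by auto
  qed
qed

lemma comm_group_Z1_nab:
  assumes "lie_yamaguti G" "lie_yamaguti H" "c \<in> Z23_nab G H"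
  shows "comm_group (Z1_nab G H c)"
proof (rule comm_groupI)
  note [simp] = Z1_nab_def nab_1cocycle_iff_shift[OF assms(2)]
  fix \<phi> assume \<phi>: "\<phi> \<in> carrier (Z1_nab G H c)"
  have neg: "(\<lambda>x. - \<phi> x) \<in> carrier (Z1_nab G H c)"
    using \<phi> shift_shift[OF assms(2,3), of "\<lambda>x. - \<phi> x" \<phi>]
    by (simp add: ly_linear_neg shift_0[OF assms(2,3)])
  then show "\<exists>\<psi>\<in>carrier (Z1_nab G H c). \<psi> \<otimes>\<^bsub>Z1_nab G H c\<^esub> \<phi> = \<one>\<^bsub>Z1_nab G H c\<^esub>"
    by (rule rev_bexI) simp
  fix \<psi> assume \<psi>: "\<psi> \<in> carrier (Z1_nab G H c)"
  show "\<phi> \<otimes>\<^bsub>Z1_nab G H c\<^esub> \<psi> \<in> carrier (Z1_nab G H c)"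
    using \<phi> \<psi> shift_shift[OF assms(2,3), of \<phi> \<psi>] by (simp add: ly_linear_add)
  show "\<phi> \<otimes>\<^bsub>Z1_nab G H c\<^esub> \<psi> = \<psi> \<otimes>\<^bsub>Z1_nab G H c\<^esub> \<phi>"
    by (simp add: add.commute)
qed (auto simp: Z1_nab_def nab_1cocycle_iff_shift[OF assms(2)] ly_linear_0[OF assms(1,2)]
    shift_0[OF assms(2,3)] add.assoc)

section \<open>Extensions with a section\<close>

locale ly_extension_section = ly_extension H E G j p
  for H :: "('k::field, 'h::ab_group_add) ly_algebra"
    and E :: "('k, 'e::ab_group_add) ly_algebra"
    and G :: "('k, 'g::ab_group_add) ly_algebra"
    and j :: "'h \<Rightarrow> 'e" and p :: "'e \<Rightarrow> 'g" +
  fixes s :: "'g \<Rightarrow> 'e"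
  assumes is_section: "ly_section E G p s"
begin

text \<open>
  The linear projection of \<open>E\<close> onto \<open>H\<close> along the image of \<open>s\<close>: every \<open>e\<close> is
  \<open>j (q e) + s (p e)\<close>. The argument of \<open>the_inv j\<close> lies in the range of \<open>j\<close>.
\<close>

definition q :: "'e \<Rightarrow> 'h" where "q e = the_inv j (e - s (p e))"

lemma p_s [simp]: "p (s x) = x" and s_linear: "ly_linear G E s"
  using is_section by (auto simp: ly_section_def)

lemmas s_rules = ly_linear_rules[OF s_linear]
lemmas j_rules = ly_hom_rules[OF j_hom]
lemmas p_rules = ly_hom_rules[OF p_hom]

lemma p_j [simp]: "p (j a) = 0"
  using exact by blast

lemma j_eq_iff [simp]: "j a = j b \<longleftrightarrow> a = b"
  using j_inj by (simp add: inj_eq)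

lemma the_inv_j [simp]: "the_inv j (j a) = a"
  using j_inj by (rule the_inv_f_f)

lemma j_the_inv: "p e = 0 \<Longrightarrow> j (the_inv j e) = e"
  using exact j_inj by (intro f_the_inv_into_f) auto

lemma decompose: "j (q e) + s (p e) = e"
  by (simp add: q_def j_the_inv p_rules)

lemma q_j [simp]: "q (j a) = a" and q_s [simp]: "q (s x) = 0"
  using the_inv_j[of 0] by (simp_all add: q_def s_rules j_rules)

lemma q_linear: "ly_linear E H q"
proof -
  have 1: "q (x + y) = q x + q y" for x y
  proof -
    have "j (q (x + y)) = j (q x + q y)"
      by (simp add: j_rules q_def j_the_inv p_rules s_rules algebra_simps)
    then show ?thesis by simp
  qed
  interpret E: vector_space "smult E" by (rule E.vector_space)
  have 2: "q (smult E k x) = smult H k (q x)" for k x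
  proof -
    have "j (q (smult E k x)) = j (smult H k (q x))"
      by (simp add: j_rules q_def j_the_inv p_rules s_rules E.scale_right_diff_distrib)
    then show ?thesis by simp
  qed
  show ?thesis by (simp add: ly_linear_iff E.vector_space H.vector_space 1 2)
qed

lemmas q_rules = ly_linear_rules[OF q_linear]

text \<open>
  The seven components of the induced cocycle, written uniformly as the \<open>H\<close>-parts of products
  of elements \<open>s x\<close> and \<open>j a\<close>.
\<close>

definition "\<chi> x y = q [s x, s y]\<^bsub>E\<^esub>"
definition "\<omega> x y z = q \<lbrace>s x, s y, s z\<rbrace>\<^bsub>E\<^esub>"
definition "\<mu> x a = q [s x, j a]\<^bsub>E\<^esub>"
definition "\<theta> x y a = q \<lbrace>j a, s x, s y\<rbrace>\<^bsub>E\<^esub>"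
definition "D x y a = q \<lbrace>s x, s y, j a\<rbrace>\<^bsub>E\<^esub>"
definition "\<rho> x a b = q \<lbrace>s x, j a, j b\<rbrace>\<^bsub>E\<^esub>"
definition "T x a b = q \<lbrace>j a, j b, s x\<rbrace>\<^bsub>E\<^esub>"

lemma induced_cocycle_eq: "induced_cocycle E G j s = (\<chi>, \<omega>, \<mu>, \<theta>, D, \<rho>, T)"
  by (simp add: induced_cocycle_def fun_eq_iff \<chi>_def \<omega>_def \<mu>_def \<theta>_def D_def \<rho>_def T_def q_def
      p_rules s_rules G.bracket_rules G.triple_rules)

text \<open>
  A multiplication table: together with multilinearity it rewrites every iterated product of
  elements \<open>j a\<close> and \<open>s x\<close> to the form \<open>j b + s y\<close>.
\<close>

lemma components:
  "[s x, s y]\<^bsub>E\<^esub> = j (\<chi> x y) + s [x, y]\<^bsub>G\<^esub>"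
  "[s x, j a]\<^bsub>E\<^esub> = j (\<mu> x a)"
  "[j a, s x]\<^bsub>E\<^esub> = - j (\<mu> x a)"
  "[j a, j b]\<^bsub>E\<^esub> = j [a, b]\<^bsub>H\<^esub>"
  "\<lbrace>s x, s y, s z\<rbrace>\<^bsub>E\<^esub> = j (\<omega> x y z) + s \<lbrace>x, y, z\<rbrace>\<^bsub>G\<^esub>"
  "\<lbrace>j a, s x, s y\<rbrace>\<^bsub>E\<^esub> = j (\<theta> x y a)"
  "\<lbrace>s x, j a, s y\<rbrace>\<^bsub>E\<^esub> = - j (\<theta> x y a)"
  "\<lbrace>s x, s y, j a\<rbrace>\<^bsub>E\<^esub> = j (D x y a)"
  "\<lbrace>s x, j a, j b\<rbrace>\<^bsub>E\<^esub> = j (\<rho> x a b)"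
  "\<lbrace>j a, s x, j b\<rbrace>\<^bsub>E\<^esub> = - j (\<rho> x a b)"
  "\<lbrace>j a, j b, s x\<rbrace>\<^bsub>E\<^esub> = j (T x a b)"
  "\<lbrace>j a, j b, j d\<rbrace>\<^bsub>E\<^esub> = j \<lbrace>a, b, d\<rbrace>\<^bsub>H\<^esub>"
proof -
  note defs = \<chi>_def \<omega>_def \<mu>_def \<theta>_def D_def \<rho>_def T_def
  have "j (q e) = e - s (p e)" for e using decompose[of e] by (simp add: algebra_simps)
  note d = this p_rules s_rules G.bracket_rules G.triple_rules
  show 1: "[s x, s y]\<^bsub>E\<^esub> = j (\<chi> x y) + s [x, y]\<^bsub>G\<^esub>"
    "[s x, j a]\<^bsub>E\<^esub> = j (\<mu> x a)"
    "\<lbrace>s x, s y, s z\<rbrace>\<^bsub>E\<^esub> = j (\<omega> x y z) + s \<lbrace>x, y, z\<rbrace>\<^bsub>G\<^esub>"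
    "\<lbrace>j a, s x, s y\<rbrace>\<^bsub>E\<^esub> = j (\<theta> x y a)"
    "\<lbrace>s x, s y, j a\<rbrace>\<^bsub>E\<^esub> = j (D x y a)"
    "\<lbrace>s x, j a, j b\<rbrace>\<^bsub>E\<^esub> = j (\<rho> x a b)"
    "\<lbrace>j a, j b, s x\<rbrace>\<^bsub>E\<^esub> = j (T x a b)" for x y z a b
    by (simp_all add: defs d)
  show "[j a, s x]\<^bsub>E\<^esub> = - j (\<mu> x a)" using E.bracket_swap[of "j a" "s x"] 1 by simp
  show "\<lbrace>s x, j a, s y\<rbrace>\<^bsub>E\<^esub> = - j (\<theta> x y a)" using E.triple_swap[of "s x" "j a"] 1 by simp
  show "\<lbrace>j a, s x, j b\<rbrace>\<^bsub>E\<^esub> = - j (\<rho> x a b)" using E.triple_swap[of "j a" "s x"] 1 by simp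
  show "[j a, j b]\<^bsub>E\<^esub> = j [a, b]\<^bsub>H\<^esub>" "\<lbrace>j a, j b, j d\<rbrace>\<^bsub>E\<^esub> = j \<lbrace>a, b, d\<rbrace>\<^bsub>H\<^esub>"
    by (simp_all add: j_rules)
qed

lemma T_swap: "T x a b = - T x b a"
  using E.triple_swap[of "j a" "j b" "s x"] by (simp add: T_def q_rules)

text \<open>
  Each cocycle identity is the \<open>H\<close>-part, under \<open>q\<close>, of a Lie-Yamaguti identity of \<open>E\<close> evaluated at
  elements of the form \<open>j a\<close> and \<open>s x\<close>.
\<close>

lemma induced_nab_cocycle: "nab_cocycle G H \<chi> \<omega> \<mu> \<theta> D \<rho> T"
proof -
  note defs = \<chi>_def \<omega>_def \<mu>_def \<theta>_def D_def \<rho>_def T_def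
  note lin = ly_linear_iff G.vector_space H.vector_space defs
    s_rules(1,5) j_rules(3,7) q_rules(1,5) E.bracket_rules E.triple_rules
  note q = components E.bracket_rules E.triple_rules q_rules algebra_simps
  show ?thesis
  proof unfold_locales
    show "bilinear_map G G H \<chi>" "bilinear_map G H H \<mu>"
      by (simp_all add: bilinear_map_def lin)
    show "trilinear_map G G G H \<omega>" "trilinear_map G G H H \<theta>" "trilinear_map G G H H D"
      "trilinear_map G H H H \<rho>" "trilinear_map G H H H T"
      by (simp_all add: trilinear_map_def lin)
  next
    fix x y z w a b c d
    show "\<chi> x y + \<chi> y x = 0"
      using arg_cong[OF E.bracket_skew[of "s x" "s y"], of q] by (simp add: q)
    show "\<omega> x y z + \<omega> y x z = 0"
      using arg_cong[OF E.triple_skew[of "s x" "s y" "s z"], of q] by (simp add: q)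
    show "D x y a + D y x a = 0"
      using arg_cong[OF E.triple_skew[of "s x" "s y" "j a"], of q] by (simp add: q)
    show "T x a b + T x b a = 0"
      using arg_cong[OF E.triple_skew[of "j a" "j b" "s x"], of q] by (simp add: q)

    show "\<chi> [x, y]\<^bsub>G\<^esub> z - \<mu> z (\<chi> x y) + \<omega> x y z
        + \<chi> [y, z]\<^bsub>G\<^esub> x - \<mu> x (\<chi> y z) + \<omega> y z x
        + \<chi> [z, x]\<^bsub>G\<^esub> y - \<mu> y (\<chi> z x) + \<omega> z x y = 0"
      using arg_cong[OF E.jacobi[of "s x" "s y" "s z"], of q] by (simp add: q)
    show "\<mu> [x, y]\<^bsub>G\<^esub> a + [\<chi> x y, a]\<^bsub>H\<^esub> + D x y a - \<mu> x (\<mu> y a) - \<theta> y x a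
        + \<mu> y (\<mu> x a) + \<theta> x y a = 0"
      using arg_cong[OF E.jacobi[of "s x" "s y" "j a"], of q] by (simp add: q)
    show "[\<mu> x a, b]\<^bsub>H\<^esub> + \<rho> x a b - \<mu> x [a, b]\<^bsub>H\<^esub> + T x a b - [\<mu> x b, a]\<^bsub>H\<^esub> - \<rho> x b a = 0"
      using arg_cong[OF E.jacobi[of "s x" "j a" "j b"], of q] by (simp add: q)

    show "\<omega> [x, y]\<^bsub>G\<^esub> z w + \<omega> [y, z]\<^bsub>G\<^esub> x w + \<omega> [z, x]\<^bsub>G\<^esub> y w
        + \<theta> z w (\<chi> x y) + \<theta> x w (\<chi> y z) + \<theta> y w (\<chi> z x) = 0"
      using arg_cong[OF E.triple_cyclic[of "s x" "s y" "s z" "s w"], of q] by (simp add: q)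
    show "D [x, y]\<^bsub>G\<^esub> z a - \<rho> z (\<chi> x y) a + D [y, z]\<^bsub>G\<^esub> x a - \<rho> x (\<chi> y z) a
        + D [z, x]\<^bsub>G\<^esub> y a - \<rho> y (\<chi> z x) a = 0"
      using arg_cong[OF E.triple_cyclic[of "s x" "s y" "s z" "j a"], of q] by (simp add: q)
    show "\<theta> [x, y]\<^bsub>G\<^esub> z a - T z (\<chi> x y) a - \<theta> x z (\<mu> y a) + \<theta> y z (\<mu> x a) = 0"
      using arg_cong[OF E.triple_cyclic[of "s x" "s y" "j a" "s z"], of q] by (simp add: q)
    show "\<rho> [x, y]\<^bsub>G\<^esub> a b + \<lbrace>\<chi> x y, a, b\<rbrace>\<^bsub>H\<^esub> - \<rho> x (\<mu> y a) b + \<rho> y (\<mu> x a) b = 0"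
      using arg_cong[OF E.triple_cyclic[of "s x" "s y" "j a" "j b"], of q] by (simp add: q)
    show "T y (\<mu> x a) b + \<theta> x y [a, b]\<^bsub>H\<^esub> - T y (\<mu> x b) a = 0"
      using arg_cong[OF E.triple_cyclic[of "s x" "j a" "j b" "s y"], of q] by (simp add: q)
    show "\<lbrace>\<mu> x a, b, c\<rbrace>\<^bsub>H\<^esub> - \<rho> x [a, b]\<^bsub>H\<^esub> c - \<lbrace>\<mu> x b, a, c\<rbrace>\<^bsub>H\<^esub> = 0"
      using arg_cong[OF E.triple_cyclic[of "s x" "j a" "j b" "j c"], of q] by (simp add: q)
    show "T x [a, b]\<^bsub>H\<^esub> c + T x [b, c]\<^bsub>H\<^esub> a + T x [c, a]\<^bsub>H\<^esub> b = 0"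
      using arg_cong[OF E.triple_cyclic[of "j a" "j b" "j c" "s x"], of q] by (simp add: q)

    show "\<omega> x y [z, w]\<^bsub>G\<^esub> + D x y (\<chi> z w) =
        \<chi> \<lbrace>x, y, z\<rbrace>\<^bsub>G\<^esub> w - \<mu> w (\<omega> x y z) + \<mu> z (\<omega> x y w) + \<chi> z \<lbrace>x, y, w\<rbrace>\<^bsub>G\<^esub>"
      using arg_cong[OF E.derivation_bracket[of "s x" "s y" "s z" "s w"], of q] by (simp add: q)
    show "D x y (\<mu> z a) = \<mu> \<lbrace>x, y, z\<rbrace>\<^bsub>G\<^esub> a + [\<omega> x y z, a]\<^bsub>H\<^esub> + \<mu> z (D x y a)"
      using arg_cong[OF E.derivation_bracket[of "s x" "s y" "s z" "j a"], of q] by (simp add: q)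
    show "\<theta> x [y, z]\<^bsub>G\<^esub> a - \<rho> x a (\<chi> y z) = \<mu> y (\<theta> x z a) - \<mu> z (\<theta> x y a)"
      using arg_cong[OF E.derivation_bracket[of "j a" "s x" "s y" "s z"], of q] by (simp add: q)
    show "D x y [a, b]\<^bsub>H\<^esub> = [D x y a, b]\<^bsub>H\<^esub> + [a, D x y b]\<^bsub>H\<^esub>"
      using arg_cong[OF E.derivation_bracket[of "s x" "s y" "j a" "j b"], of q] by (simp add: q)
    show "\<rho> x a (\<mu> y b) + [\<theta> x y a, b]\<^bsub>H\<^esub> - \<mu> y (\<rho> x a b) = 0"
      using arg_cong[OF E.derivation_bracket[of "s x" "j a" "s y" "j b"], of q] by (simp add: q)
    show "T [x, y]\<^bsub>G\<^esub> a b + \<lbrace>a, b, \<chi> x y\<rbrace>\<^bsub>H\<^esub> - \<mu> x (T y a b) + \<mu> y (T x a b) = 0"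
      using arg_cong[OF E.derivation_bracket[of "j a" "j b" "s x" "s y"], of q] by (simp add: q)
    show "\<lbrace>a, b, \<mu> x c\<rbrace>\<^bsub>H\<^esub> = \<mu> x \<lbrace>a, b, c\<rbrace>\<^bsub>H\<^esub> - [c, T x a b]\<^bsub>H\<^esub>"
      using arg_cong[OF E.derivation_bracket[of "j a" "j b" "s x" "j c"], of q]
        H.bracket_swap[of c "T x a b"] by (simp add: q)
    show "\<rho> x a [b, c]\<^bsub>H\<^esub> = [\<rho> x a b, c]\<^bsub>H\<^esub> + [b, \<rho> x a c]\<^bsub>H\<^esub>"
      using arg_cong[OF E.derivation_bracket[of "s x" "j a" "j b" "j c"], of q] by (simp add: q)

    fix x1 x2 y1 y2 y3
    show "D x1 x2 (\<omega> y1 y2 y3) + \<omega> x1 x2 \<lbrace>y1, y2, y3\<rbrace>\<^bsub>G\<^esub> =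
        \<omega> \<lbrace>x1, x2, y1\<rbrace>\<^bsub>G\<^esub> y2 y3 + \<theta> y2 y3 (\<omega> x1 x2 y1)
        + \<omega> y1 \<lbrace>x1, x2, y2\<rbrace>\<^bsub>G\<^esub> y3 - \<theta> y1 y3 (\<omega> x1 x2 y2)
        + \<omega> y1 y2 \<lbrace>x1, x2, y3\<rbrace>\<^bsub>G\<^esub> + D y1 y2 (\<omega> x1 x2 y3)"
      using arg_cong[OF E.derivation_triple[of "s x1" "s x2" "s y1" "s y2" "s y3"], of q]
      by (simp add: q)
    show "D x y (\<theta> z w a) - \<theta> z w (D x y a) =
        \<theta> \<lbrace>x, y, z\<rbrace>\<^bsub>G\<^esub> w a + \<theta> z \<lbrace>x, y, w\<rbrace>\<^bsub>G\<^esub> a - T w (\<omega> x y z) a - \<rho> z a (\<omega> x y w)"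
      using arg_cong[OF E.derivation_triple[of "s x" "s y" "j a" "s z" "s w"], of q]
        T_swap[of w a "\<omega> x y z"]
      by (simp add: q)
    show "\<theta> x \<lbrace>y, z, w\<rbrace>\<^bsub>G\<^esub> a - \<rho> x a (\<omega> y z w) =
        \<theta> z w (\<theta> x y a) - \<theta> y w (\<theta> x z a) + D y z (\<theta> x w a)"
      using arg_cong[OF E.derivation_triple[of "j a" "s x" "s y" "s z" "s w"], of q]
      by (simp add: q)
    show "D x y (D z w a) - D z w (D x y a) =
        D \<lbrace>x, y, z\<rbrace>\<^bsub>G\<^esub> w a + D z \<lbrace>x, y, w\<rbrace>\<^bsub>G\<^esub> a - \<rho> w (\<omega> x y z) a + \<rho> z (\<omega> x y w) a"
      using arg_cong[OF E.derivation_triple[of "s x" "s y" "s z" "s w" "j a"], of q]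
      by (simp add: q)
    show "D x y (\<rho> z a b) - \<rho> \<lbrace>x, y, z\<rbrace>\<^bsub>G\<^esub> a b =
        \<rho> z (D x y a) b + \<rho> z a (D x y b) + \<lbrace>\<omega> x y z, a, b\<rbrace>\<^bsub>H\<^esub>"
      using arg_cong[OF E.derivation_triple[of "s x" "s y" "s z" "j a" "j b"], of q]
      by (simp add: q)
    show "D y z (\<rho> x a b) = \<rho> x a (D y z b) - \<rho> z (\<theta> x y a) b + \<rho> y (\<theta> x z a) b"
      using arg_cong[OF E.derivation_triple[of "s x" "j a" "s y" "s z" "j b"], of q]
      by (simp add: q)
    show "\<theta> y z (\<rho> x a b) = \<rho> x a (\<theta> y z b) - T z (\<theta> x y a) b - \<rho> y b (\<theta> x z a)"
      using arg_cong[OF E.derivation_triple[of "s x" "j a" "j b" "s y" "s z"], of q]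
        T_swap[of z b "\<theta> x y a"]
      by (simp add: q)
    show "D x y (T z a b) - T \<lbrace>x, y, z\<rbrace>\<^bsub>G\<^esub> a b =
        T z (D x y a) b + T z a (D x y b) + \<lbrace>a, b, \<omega> x y z\<rbrace>\<^bsub>H\<^esub>"
      using arg_cong[OF E.derivation_triple[of "s x" "s y" "j a" "j b" "s z"], of q]
      by (simp add: q)
    show "T \<lbrace>x, y, z\<rbrace>\<^bsub>G\<^esub> a b - D x y (T z a b) + \<lbrace>a, b, \<omega> x y z\<rbrace>\<^bsub>H\<^esub> =
        \<theta> y z (T x a b) - \<theta> x z (T y a b)"
      using arg_cong[OF E.derivation_triple[of "j a" "j b" "s x" "s y" "s z"], of q]
      by (simp add: q)
    show "D x y \<lbrace>a, b, c\<rbrace>\<^bsub>H\<^esub> =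
        \<lbrace>D x y a, b, c\<rbrace>\<^bsub>H\<^esub> + \<lbrace>a, D x y b, c\<rbrace>\<^bsub>H\<^esub> + \<lbrace>a, b, D x y c\<rbrace>\<^bsub>H\<^esub>"
      using arg_cong[OF E.derivation_triple[of "s x" "s y" "j a" "j b" "j c"], of q]
      by (simp add: q)
    show "\<rho> x a (\<rho> y b c) = \<rho> y (\<rho> x a b) c + \<rho> y b (\<rho> x a c) - \<lbrace>\<theta> x y a, b, c\<rbrace>\<^bsub>H\<^esub>"
      using arg_cong[OF E.derivation_triple[of "s x" "j a" "s y" "j b" "j c"], of q]
      by (simp add: q)
    show "\<lbrace>a, b, \<theta> x y c\<rbrace>\<^bsub>H\<^esub> = \<theta> x y \<lbrace>a, b, c\<rbrace>\<^bsub>H\<^esub> - T y (T x a b) c - \<rho> x c (T y a b)"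
      using arg_cong[OF E.derivation_triple[of "j a" "j b" "j c" "s x" "s y"], of q]
        T_swap[of y c "T x a b"]
      by (simp add: q)
    show "\<rho> x a (T y b c) = T y (\<rho> x a b) c + T y b (\<rho> x a c) - \<lbrace>b, c, \<theta> x y a\<rbrace>\<^bsub>H\<^esub>"
      using arg_cong[OF E.derivation_triple[of "s x" "j a" "j b" "j c" "s y"], of q]
      by (simp add: q)
    show "\<lbrace>a, b, D x y c\<rbrace>\<^bsub>H\<^esub> = D x y \<lbrace>a, b, c\<rbrace>\<^bsub>H\<^esub> - \<rho> y (T x a b) c + \<rho> x (T y a b) c"
      using arg_cong[OF E.derivation_triple[of "j a" "j b" "s x" "s y" "j c"], of q]
      by (simp add: q)
    show "\<lbrace>a, b, \<rho> x c d\<rbrace>\<^bsub>H\<^esub> = \<rho> x \<lbrace>a, b, c\<rbrace>\<^bsub>H\<^esub> d - \<lbrace>c, T x a b, d\<rbrace>\<^bsub>H\<^esub> + \<rho> x c \<lbrace>a, b, d\<rbrace>\<^bsub>H\<^esub>"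
      using arg_cong[OF E.derivation_triple[of "j a" "j b" "s x" "j c" "j d"], of q]
        H.triple_swap[of c "T x a b" d]
      by (simp add: q)
    show "\<rho> x a \<lbrace>b, c, d\<rbrace>\<^bsub>H\<^esub> =
        \<lbrace>\<rho> x a b, c, d\<rbrace>\<^bsub>H\<^esub> + \<lbrace>b, \<rho> x a c, d\<rbrace>\<^bsub>H\<^esub> + \<lbrace>b, c, \<rho> x a d\<rbrace>\<^bsub>H\<^esub>"
      using arg_cong[OF E.derivation_triple[of "s x" "j a" "j b" "j c" "j d"], of q]
      by (simp add: q)
    show "\<lbrace>a, b, T x c d\<rbrace>\<^bsub>H\<^esub> = T x \<lbrace>a, b, c\<rbrace>\<^bsub>H\<^esub> d + T x c \<lbrace>a, b, d\<rbrace>\<^bsub>H\<^esub> + \<lbrace>c, d, T x a b\<rbrace>\<^bsub>H\<^esub>"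
      using arg_cong[OF E.derivation_triple[of "j a" "j b" "j c" "j d" "s x"], of q]
      by (simp add: q)
  qed
qed

lemma induced_in_Z23: "induced_cocycle E G j s \<in> Z23_nab G H"
  by (simp add: Z23_nab_def induced_cocycle_eq induced_nab_cocycle)

lemma shifted_section:
  assumes "ly_linear G H \<phi>"
  shows "ly_extension_section H E G j p (\<lambda>x. s x - j (\<phi> x))"
    and "induced_cocycle E G j (\<lambda>x. s x - j (\<phi> x)) = shift G H \<phi> (induced_cocycle E G j s)"
proof -
  interpret E: vector_space "smult E" by (rule E.vector_space)
  note \<phi> = ly_linear_rules[OF assms]
  show "ly_extension_section H E G j p (\<lambda>x. s x - j (\<phi> x))"
    by unfold_locales
      (simp add: ly_section_def ly_linear_iff E.vector_space G.vector_space s_rules j_rules \<phi>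
        p_rules E.scale_right_diff_distrib)
  have inv: "the_inv j e = a" if "e = j a" for e a using that by simp
  note rules = components E.bracket_rules E.triple_rules j_rules(3-6) algebra_simps
  show "induced_cocycle E G j (\<lambda>x. s x - j (\<phi> x)) = shift G H \<phi> (induced_cocycle E G j s)"
    unfolding induced_cocycle_eq unfolding induced_cocycle_def shift.simps prod.inject fun_eq_iff
    apply (intro conjI allI; rule inv)
    subgoal by (simp add: rules)
    subgoal by (simp add: rules)
    subgoal for x a using H.bracket_swap[of a "\<phi> x"] by (simp add: rules)
    subgoal by (simp add: rules)
    subgoal by (simp add: rules)
    subgoal for x a b using H.triple_swap[of a "\<phi> x" b] by (simp add: rules)
    subgoal for x a b using H.triple_swap[of a b "\<phi> x"] by (simp add: rules)
    done
qed

text \<open>Two sections of \<open>p\<close> differ by a linear map into the kernel of \<open>p\<close>, the image of \<open>j\<close>.\<close>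

lemma section_is_shifted:
  assumes "ly_section E G p s'"
  obtains \<phi> where "ly_linear G H \<phi>" "s' = (\<lambda>x. s x - j (\<phi> x))"
proof
  have lin: "ly_linear G E s'" and sec: "p (s' x) = x" for x
    using assms by (auto simp: ly_section_def)
  show "ly_linear G H (\<lambda>x. - q (s' x))"
    using ly_linear_neg[OF Vector_Spaces.linear_compose[OF lin q_linear]] by (simp add: o_def)
  show "s' = (\<lambda>x. s x - j (- q (s' x)))"
    using decompose[of "s' _"] by (simp add: fun_eq_iff sec j_rules add.commute)
qed

text \<open>
  Twisting a cocycle amounts to relabelling \<open>H\<close> by \<open>\<beta>\<close> and \<open>G\<close> by \<open>\<alpha>\<close> in the extension. In
  particular the twisted septuple is induced by an extension, hence is a cocycle.
\<close>

lemma twisted_extension: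
  assumes "ly_hom G G \<alpha>" "bij \<alpha>" "ly_hom H H \<beta>" "bij \<beta>"
  shows "ly_extension_section H E G (j \<circ> the_inv \<beta>) (\<alpha> \<circ> p) (s \<circ> the_inv \<alpha>)"
    and "induced_cocycle E G (j \<circ> the_inv \<beta>) (s \<circ> the_inv \<alpha>)
      = twist (\<alpha>, \<beta>) (induced_cocycle E G j s)"
proof -
  note \<alpha>' = ly_hom_the_inv[OF G.lie_yamaguti_axioms assms(1,2)]
  note \<beta>' = ly_hom_the_inv[OF H.lie_yamaguti_axioms assms(3,4)]
  have \<alpha>0: "\<alpha> x = 0 \<longleftrightarrow> x = 0" for x
    using ly_hom_rules(6)[OF assms(1)] \<alpha>'(4) by metis
  have range_eq: "range (j \<circ> the_inv \<beta>) = range j"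
    unfolding image_comp[symmetric] using \<beta>'(2) by (simp only: bij_is_surj)
  show "ly_extension_section H E G (j \<circ> the_inv \<beta>) (\<alpha> \<circ> p) (s \<circ> the_inv \<alpha>)"
  proof unfold_locales
    show "ly_hom H E (j \<circ> the_inv \<beta>)" by (rule ly_hom_comp[OF \<beta>'(1) j_hom])
    show "ly_hom E G (\<alpha> \<circ> p)" by (rule ly_hom_comp[OF p_hom assms(1)])
    show "inj (j \<circ> the_inv \<beta>)" using j_inj \<beta>'(2) by (simp add: inj_compose bij_is_inj)
    show "surj (\<alpha> \<circ> p)" by (rule comp_surj[OF p_surj bij_is_surj[OF assms(2)]])
    show "range (j \<circ> the_inv \<beta>) = {e. (\<alpha> \<circ> p) e = 0}" 
      unfolding range_eq exact by (simp add: \<alpha>0)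
    have "ly_linear G G (the_inv \<alpha>)" using \<alpha>'(1) by (simp add: ly_hom_def)
    then show "ly_section E G (\<alpha> \<circ> p) (s \<circ> the_inv \<alpha>)"
      using Vector_Spaces.linear_compose[OF _ s_linear] by (simp add: ly_section_def \<alpha>'(3))
  qed
  then interpret tw: ly_extension_section H E G "j \<circ> the_inv \<beta>" "\<alpha> \<circ> p" "s \<circ> the_inv \<alpha>" .
  have inv: "the_inv (j \<circ> the_inv \<beta>) (j a) = \<beta> a" for a
    using tw.the_inv_j[of "\<beta> a"] by (simp add: \<beta>'(4))
  show "induced_cocycle E G (j \<circ> the_inv \<beta>) (s \<circ> the_inv \<alpha>)
      = twist (\<alpha>, \<beta>) (induced_cocycle E G j s)"
    unfolding induced_cocycle_eq
    by (simp add: Let_def induced_cocycle_def fun_eq_iff ly_hom_rules(1,2)[OF \<alpha>'(1)]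
        components inv)
qed

context
  fixes E2 :: "('k, 'e2::ab_group_add) ly_algebra"
    and j2 :: "'h \<Rightarrow> 'e2" and p2 :: "'e2 \<Rightarrow> 'g" and s2 :: "'g \<Rightarrow> 'e2"
  assumes ext2: "ly_extension_section H E2 G j2 p2 s2"
begin

interpretation E2: ly_extension_section H E2 G j2 p2 s2 by (rule ext2)

text \<open>
  The induced cocycle, together with \<open>H\<close> and \<open>G\<close>, determines all products in the extension.
\<close>

lemma hom_iff_induced_cocycle_eq:
  assumes lin: "ly_linear E E2 \<gamma>" and \<gamma>j: "\<And>a. \<gamma> (j a) = j2 a" and \<gamma>s: "\<And>x. \<gamma> (s x) = s2 x"
  shows "ly_hom E E2 \<gamma> \<longleftrightarrow> induced_cocycle E G j s = induced_cocycle E2 G j2 s2"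
proof
  note \<gamma> = ly_linear_rules[OF lin] \<gamma>j \<gamma>s
  {
    assume "ly_hom E E2 \<gamma>"
    then have b: "\<gamma> [x, y]\<^bsub>E\<^esub> = [\<gamma> x, \<gamma> y]\<^bsub>E2\<^esub>" and t: "\<gamma> \<lbrace>x, y, z\<rbrace>\<^bsub>E\<^esub> = \<lbrace>\<gamma> x, \<gamma> y, \<gamma> z\<rbrace>\<^bsub>E2\<^esub>"
      for x y z by (simp_all add: ly_hom_rules)
    show "induced_cocycle E G j s = induced_cocycle E2 G j2 s2"
      unfolding induced_cocycle_eq E2.induced_cocycle_eq prod.inject fun_eq_iff
      apply (intro conjI allI)
      subgoal for x y using b[of "s x" "s y"] by (simp add: components E2.components \<gamma>)
      subgoal for x y z using t[of "s x" "s y" "s z"] by (simp add: components E2.components \<gamma>)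
      subgoal for x a using b[of "s x" "j a"] by (simp add: components E2.components \<gamma>)
      subgoal for x y a using t[of "j a" "s x" "s y"] by (simp add: components E2.components \<gamma>)
      subgoal for x y a using t[of "s x" "s y" "j a"] by (simp add: components E2.components \<gamma>)
      subgoal for x a b using t[of "s x" "j a" "j b"] by (simp add: components E2.components \<gamma>)
      subgoal for x a b using t[of "j a" "j b" "s x"] by (simp add: components E2.components \<gamma>)
      done
  }
  assume "induced_cocycle E G j s = induced_cocycle E2 G j2 s2"
  then have eq: "\<chi> = E2.\<chi>" "\<omega> = E2.\<omega>" "\<mu> = E2.\<mu>" "\<theta> = E2.\<theta>" "D = E2.D" "\<rho> = E2.\<rho>" "T = E2.T"
    by (simp_all add: induced_cocycle_eq E2.induced_cocycle_eq)
  note rules = components E2.components E.bracket_rules E.triple_rules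
    E2.E.bracket_rules E2.E.triple_rules \<gamma> eq
  show "ly_hom E E2 \<gamma>" unfolding ly_hom_def
  proof (intro conjI allI lin)
    have b: "\<gamma> [j a + s x, j b + s y]\<^bsub>E\<^esub> = [\<gamma> (j a + s x), \<gamma> (j b + s y)]\<^bsub>E2\<^esub>" for a b x y
      by (simp add: rules)
    show "\<gamma> [e, f]\<^bsub>E\<^esub> = [\<gamma> e, \<gamma> f]\<^bsub>E2\<^esub>" for e f
      using b[of "q e" "p e" "q f" "p f"] by (simp only: decompose)
    have t: "\<gamma> \<lbrace>j a + s x, j b + s y, j d + s z\<rbrace>\<^bsub>E\<^esub>
        = \<lbrace>\<gamma> (j a + s x), \<gamma> (j b + s y), \<gamma> (j d + s z)\<rbrace>\<^bsub>E2\<^esub>" for a b d x y z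
      by (simp add: rules)
    show "\<gamma> \<lbrace>e, f, g\<rbrace>\<^bsub>E\<^esub> = \<lbrace>\<gamma> e, \<gamma> f, \<gamma> g\<rbrace>\<^bsub>E2\<^esub>" for e f g
      using t[of "q e" "p e" "q f" "p f" "q g" "p g"] by (simp only: decompose)
  qed
qed

text \<open>
  The unique linear map \<open>E \<rightarrow> E2\<close> with \<open>j a \<mapsto> j2 a\<close> and \<open>s x \<mapsto> s2 x\<close>.
\<close>

definition glue :: "'e \<Rightarrow> 'e2" where "glue e = j2 (q e) + s2 (p e)"

lemma glue_linear: "ly_linear E E2 glue"
proof -
  interpret E2: vector_space "smult E2" by (rule E2.E.vector_space)
  show ?thesis
    by (simp add: ly_linear_iff E.vector_space E2.E.vector_space glue_def q_rules p_rules
        E2.s_rules E2.j_rules algebra_simps E2.scale_right_distrib)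
qed

lemma glue_j [simp]: "glue (j a) = j2 a" and glue_s [simp]: "glue (s x) = s2 x"
  by (simp_all add: glue_def E2.s_rules E2.j_rules)

lemma bij_glue: "bij glue"
proof (rule o_bij[of "\<lambda>e. j (E2.q e) + s (p2 e)"])
  show "(\<lambda>e. j (E2.q e) + s (p2 e)) \<circ> glue = id"
    by (simp add: fun_eq_iff glue_def E2.q_rules E2.p_rules decompose)
  show "glue \<circ> (\<lambda>e. j (E2.q e) + s (p2 e)) = id"
    by (simp add: fun_eq_iff glue_def q_rules p_rules E2.decompose)
qed

end

section \<open>The Wells sequence\<close>

lemma wells_i_eq: "wells_i j p s \<phi> e = e - j (\<phi> (p e))"
  using decompose[of e] by (simp add: wells_i_def Let_def q_def)

lemma wells_i_hom_iff:
  assumes "ly_linear G H \<phi>"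
  shows "ly_hom E E (wells_i j p s \<phi>)
    \<longleftrightarrow> \<phi> \<in> carrier (Z1_nab G H (induced_cocycle E G j s))"
proof -
  note ext = shifted_section[OF assms]
  have eq: "wells_i j p s \<phi> = glue j (\<lambda>x. s x - j (\<phi> x))"
    using decompose by (auto simp: fun_eq_iff wells_i_eq glue_def[OF ext(1)] algebra_simps)
  have "ly_hom E E (wells_i j p s \<phi>)
      \<longleftrightarrow> induced_cocycle E G j s = shift G H \<phi> (induced_cocycle E G j s)"
    unfolding ext(2)[symmetric]
    by (rule hom_iff_induced_cocycle_eq[OF ext(1)])
      (simp_all add: eq glue_linear[OF ext(1)] glue_j[OF ext(1)] glue_s[OF ext(1)])
  then show ?thesis
    using assms by (auto simp: Z1_nab_def nab_1cocycle_iff_shift[OF H.lie_yamaguti_axioms])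
qed

text \<open>The map \<open>j \<circ> \<psi>\<close> takes values in the kernel of \<open>p\<close>, so composing adds the two maps.\<close>

lemma wells_i_comp:
  "wells_i j p s (\<lambda>x. \<phi> x + \<psi> x) = wells_i j p s \<phi> \<circ> wells_i j p s \<psi>"
  by (simp add: fun_eq_iff wells_i_eq p_rules j_rules)

lemma wells_i_in_Aut:
  assumes "\<phi> \<in> carrier (Z1_nab G H (induced_cocycle E G j s))"
  shows "wells_i j p s \<phi> \<in> carrier (ly_Aut_stab E (range j))"
proof -
  have lin: "ly_linear G H \<phi>"
    using assms by (simp add: Z1_nab_def nab_1cocycle_iff_shift[OF H.lie_yamaguti_axioms])
  have 0: "\<phi> 0 = 0" by (rule ly_linear_rules[OF lin])
  have id: "wells_i j p s (\<lambda>x. 0) = id" by (simp add: fun_eq_iff wells_i_eq j_rules)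
  have "bij (wells_i j p s \<phi>)"
    using wells_i_comp[of \<phi> "\<lambda>x. - \<phi> x"] wells_i_comp[of "\<lambda>x. - \<phi> x" \<phi>]
    by (intro o_bij[of "wells_i j p s (\<lambda>x. - \<phi> x)"]) (simp_all add: id)
  moreover have "wells_i j p s \<phi> ` range j = range j"
    by (simp add: image_image wells_i_eq 0 j_rules)
  ultimately show ?thesis
    using assms wells_i_hom_iff[OF lin] by (simp add: ly_Aut_stab_def ly_Aut_def)
qed

lemma Aut_stabD:
  assumes "\<gamma> \<in> carrier (ly_Aut_stab E (range j))"
  shows "ly_hom E E \<gamma>" "bij \<gamma>" "\<gamma> ` range j = range j"
  using assms by (auto simp: ly_Aut_stab_def ly_Aut_def)

text \<open>
  The pair \<open>K \<gamma>\<close> is characterised by \<open>\<gamma> \<circ> j = j \<circ> \<beta>\<close> and \<open>p \<circ> \<gamma> = \<alpha> \<circ> p\<close>, without reference to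
  the section; this makes the multiplicativity of \<open>K\<close> immediate.
\<close>

lemma wells_K_eqI:
  assumes "\<And>a. \<gamma> (j a) = j (\<beta> a)" "\<And>e. p (\<gamma> e) = \<alpha> (p e)"
  shows "wells_K j p s \<gamma> = (\<alpha>, \<beta>)"
  using assms by (simp add: wells_K_def fun_eq_iff)

lemma wells_K_intertwines:
  assumes "\<gamma> \<in> carrier (ly_Aut_stab E (range j))"
  shows "\<gamma> (j a) = j (snd (wells_K j p s \<gamma>) a)" "p (\<gamma> e) = fst (wells_K j p s \<gamma>) (p e)"
proof -
  note Aut_stabD[OF assms]
  then have \<gamma>: "ly_hom E E \<gamma>" "\<gamma> ` range j = range j"
    by blast+
  have ker: "p (\<gamma> (j a)) = 0" for a
    using \<gamma>(2) exact by blast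
  show "\<gamma> (j a) = j (snd (wells_K j p s \<gamma>) a)"
    by (simp add: wells_K_def j_the_inv ker)
  have "p (\<gamma> (j (q e) + s (p e))) = p (\<gamma> (s (p e)))"
    by (simp add: ly_hom_rules[OF \<gamma>(1)] p_rules ker)
  then show "p (\<gamma> e) = fst (wells_K j p s \<gamma>) (p e)"
    by (simp add: wells_K_def decompose)
qed

lemma wells_K_comp:
  assumes "\<gamma> \<in> carrier (ly_Aut_stab E (range j))" "\<delta> \<in> carrier (ly_Aut_stab E (range j))"
  shows "wells_K j p s (\<gamma> \<circ> \<delta>) = (fst (wells_K j p s \<gamma>) \<circ> fst (wells_K j p s \<delta>),
    snd (wells_K j p s \<gamma>) \<circ> snd (wells_K j p s \<delta>))"
  by (rule wells_K_eqI) (simp_all add: wells_K_intertwines[OF assms(1)] wells_K_intertwines[OF assms(2)])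

lemma the_inv_in_Aut_stab:
  assumes "\<gamma> \<in> carrier (ly_Aut_stab E (range j))"
  shows "the_inv \<gamma> \<in> carrier (ly_Aut_stab E (range j))"
    and "\<gamma> \<circ> the_inv \<gamma> = id" and "the_inv \<gamma> \<circ> \<gamma> = id"
proof -
  note Aut_stabD[OF assms]
  then have \<gamma>: "ly_hom E E \<gamma>" "bij \<gamma>" "\<gamma> ` range j = range j"
    by blast+
  note inv = ly_hom_the_inv[OF E.lie_yamaguti_axioms \<gamma>(1,2)]
  show id: "\<gamma> \<circ> the_inv \<gamma> = id" "the_inv \<gamma> \<circ> \<gamma> = id" using inv(3,4) by (simp_all add: fun_eq_iff)
  have "the_inv \<gamma> ` \<gamma> ` range j = (the_inv \<gamma> \<circ> \<gamma>) ` range j" by (rule image_comp)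
  then have "the_inv \<gamma> ` \<gamma> ` range j = range j" by (simp only: id image_id id_apply)
  then show "the_inv \<gamma> \<in> carrier (ly_Aut_stab E (range j))"
    using inv(1,2) \<gamma>(3) by (simp add: ly_Aut_stab_def ly_Aut_def)
qed

lemma wells_K_in_Aut:
  assumes "\<gamma> \<in> carrier (ly_Aut_stab E (range j))"
  shows "wells_K j p s \<gamma> \<in> carrier (ly_Aut G \<times>\<times> ly_Aut H)"
proof -
  define \<alpha> \<beta> where "\<alpha> = fst (wells_K j p s \<gamma>)" and "\<beta> = snd (wells_K j p s \<gamma>)"
  have \<gamma>: "ly_hom E E \<gamma>" using assms by (rule Aut_stabD)
  have \<beta>: "\<gamma> (j a) = j (\<beta> a)" and \<alpha>: "p (\<gamma> e) = \<alpha> (p e)" for a e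
    using wells_K_intertwines[OF assms] by (simp_all add: \<alpha>_def \<beta>_def)
  note inv = the_inv_in_Aut_stab[OF assms]
  \<comment> \<open>Bijectivity comes from multiplicativity of \<open>K\<close>, applied to \<open>\<gamma>\<close> and its inverse.\<close>
  have id: "wells_K j p s id = (id, id)" by (rule wells_K_eqI) simp_all
  define \<alpha>' \<beta>' where "\<alpha>' = fst (wells_K j p s (the_inv \<gamma>))"
    and "\<beta>' = snd (wells_K j p s (the_inv \<gamma>))"
  have "\<alpha> \<circ> \<alpha>' = id" "\<beta> \<circ> \<beta>' = id" "\<alpha>' \<circ> \<alpha> = id" "\<beta>' \<circ> \<beta> = id"
    using wells_K_comp[OF assms inv(1)] wells_K_comp[OF inv(1) assms]
    by (simp_all add: inv id \<alpha>_def \<beta>_def \<alpha>'_def \<beta>'_def)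
  then have "bij \<alpha>" "bij \<beta>" by (blast intro: o_bij)+
  moreover have "ly_hom G G \<alpha>"
  proof (rule ly_homI)
    fix x y z k
    have [simp]: "\<alpha> x = p (\<gamma> (s x))" for x using \<alpha>[of "s x"] by simp
    show "\<alpha> (x + y) = \<alpha> x + \<alpha> y" "\<alpha> (smult G k x) = smult G k (\<alpha> x)"
      by (simp_all add: s_rules ly_hom_rules[OF \<gamma>] p_rules)
    have "\<alpha> (p [s x, s y]\<^bsub>E\<^esub>) = [\<alpha> x, \<alpha> y]\<^bsub>G\<^esub>" "\<alpha> (p \<lbrace>s x, s y, s z\<rbrace>\<^bsub>E\<^esub>) = \<lbrace>\<alpha> x, \<alpha> y, \<alpha> z\<rbrace>\<^bsub>G\<^esub>"
      unfolding \<alpha>[symmetric] by (simp_all add: ly_hom_rules[OF \<gamma>] p_rules)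
    then show "\<alpha> [x, y]\<^bsub>G\<^esub> = [\<alpha> x, \<alpha> y]\<^bsub>G\<^esub>" "\<alpha> \<lbrace>x, y, z\<rbrace>\<^bsub>G\<^esub> = \<lbrace>\<alpha> x, \<alpha> y, \<alpha> z\<rbrace>\<^bsub>G\<^esub>"
      by (simp_all only: p_rules p_s)
  qed (rule G.vector_space)+
  moreover have "ly_hom H H \<beta>"
  proof (rule ly_homI)
    fix x y z k
    have "j (\<beta> (x + y)) = j (\<beta> x + \<beta> y)" "j (\<beta> (smult H k x)) = j (smult H k (\<beta> x))"
      "j (\<beta> [x, y]\<^bsub>H\<^esub>) = j [\<beta> x, \<beta> y]\<^bsub>H\<^esub>" "j (\<beta> \<lbrace>x, y, z\<rbrace>\<^bsub>H\<^esub>) = j \<lbrace>\<beta> x, \<beta> y, \<beta> z\<rbrace>\<^bsub>H\<^esub>"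
      unfolding \<beta>[symmetric] j_rules ly_hom_rules[OF \<gamma>] by (rule refl)+
    then show "\<beta> (x + y) = \<beta> x + \<beta> y" "\<beta> (smult H k x) = smult H k (\<beta> x)"
      "\<beta> [x, y]\<^bsub>H\<^esub> = [\<beta> x, \<beta> y]\<^bsub>H\<^esub>" "\<beta> \<lbrace>x, y, z\<rbrace>\<^bsub>H\<^esub> = \<lbrace>\<beta> x, \<beta> y, \<beta> z\<rbrace>\<^bsub>H\<^esub>"
      by simp_all
  qed (rule H.vector_space)+
  ultimately show ?thesis
    by (simp add: DirProd_def ly_Aut_def mem_Times_iff \<alpha>_def \<beta>_def)
qed

lemma group_hom_wells_K:
  "group_hom (ly_Aut_stab E (range j)) (ly_Aut G \<times>\<times> ly_Aut H) (wells_K j p s)"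
proof (intro group_hom.intro group_hom_axioms.intro homI)
  show "group (ly_Aut_stab E (range j))" by (rule group_ly_Aut_stab) unfold_locales
  show "group (ly_Aut G \<times>\<times> ly_Aut H)"
    by (intro DirProd_group group_ly_Aut) unfold_locales
  fix \<gamma> \<delta> assume *: "\<gamma> \<in> carrier (ly_Aut_stab E (range j))" "\<delta> \<in> carrier (ly_Aut_stab E (range j))"
  show "wells_K j p s \<gamma> \<in> carrier (ly_Aut G \<times>\<times> ly_Aut H)" by (rule wells_K_in_Aut) fact
  have "\<gamma> \<otimes>\<^bsub>ly_Aut_stab E (range j)\<^esub> \<delta> = \<gamma> \<circ> \<delta>" by (simp add: ly_Aut_stab_def ly_Aut_def)
  then show "wells_K j p s (\<gamma> \<otimes>\<^bsub>ly_Aut_stab E (range j)\<^esub> \<delta>)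
      = wells_K j p s \<gamma> \<otimes>\<^bsub>ly_Aut G \<times>\<times> ly_Aut H\<^esub> wells_K j p s \<delta>"
    using wells_K_comp[OF *] by (simp add: DirProd_def ly_Aut_def case_prod_beta)
qed

lemma group_hom_wells_i:
  "group_hom (Z1_nab G H (induced_cocycle E G j s)) (ly_Aut_stab E (range j)) (wells_i j p s)"
proof (intro group_hom.intro group_hom_axioms.intro homI)
  show "group (Z1_nab G H (induced_cocycle E G j s))"
    by (intro comm_group.axioms(2) comm_group_Z1_nab induced_in_Z23) unfold_locales
  show "group (ly_Aut_stab E (range j))" by (rule group_ly_Aut_stab) unfold_locales
  fix \<phi> \<psi> assume "\<phi> \<in> carrier (Z1_nab G H (induced_cocycle E G j s))"
  then show "wells_i j p s \<phi> \<in> carrier (ly_Aut_stab E (range j))" by (rule wells_i_in_Aut)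
  show "wells_i j p s (\<phi> \<otimes>\<^bsub>Z1_nab G H (induced_cocycle E G j s)\<^esub> \<psi>)
      = wells_i j p s \<phi> \<otimes>\<^bsub>ly_Aut_stab E (range j)\<^esub> wells_i j p s \<psi>"
    by (simp add: wells_i_comp ly_Aut_stab_def ly_Aut_def Z1_nab_def)
qed

lemma inj_wells_i: "inj (wells_i j p s)"
proof (rule injI, rule ext)
  fix \<phi> \<psi> x assume "wells_i j p s \<phi> = wells_i j p s \<psi>"
  then have "wells_i j p s \<phi> (s x) = wells_i j p s \<psi> (s x)" by simp
  then show "\<phi> x = \<psi> x" by (simp add: wells_i_eq)
qed

lemma image_wells_i:
  "wells_i j p s ` carrier (Z1_nab G H (induced_cocycle E G j s))
    = kernel (ly_Aut_stab E (range j)) (ly_Aut G \<times>\<times> ly_Aut H) (wells_K j p s)"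
proof (intro equalityI subsetI)
  have one: "\<one>\<^bsub>ly_Aut G \<times>\<times> ly_Aut H\<^esub> = (id, id)" by (simp add: DirProd_def ly_Aut_def)
  fix \<gamma>
  {
    assume "\<gamma> \<in> wells_i j p s ` carrier (Z1_nab G H (induced_cocycle E G j s))"
    then obtain \<phi> where \<phi>: "\<phi> \<in> carrier (Z1_nab G H (induced_cocycle E G j s))"
      and \<gamma>: "\<gamma> = wells_i j p s \<phi>" by blast
    have "ly_linear G H \<phi>"
      using \<phi> by (simp add: Z1_nab_def nab_1cocycle_iff_shift[OF H.lie_yamaguti_axioms])
    then have "\<phi> 0 = 0" by (rule ly_linear_rules)
    then have "wells_K j p s \<gamma> = (id, id)"
      by (intro wells_K_eqI) (simp_all add: \<gamma> wells_i_eq p_rules j_rules)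
    then show "\<gamma> \<in> kernel (ly_Aut_stab E (range j)) (ly_Aut G \<times>\<times> ly_Aut H) (wells_K j p s)"
      using wells_i_in_Aut[OF \<phi>] unfolding kernel_def one \<gamma> by simp
  }
  assume "\<gamma> \<in> kernel (ly_Aut_stab E (range j)) (ly_Aut G \<times>\<times> ly_Aut H) (wells_K j p s)"
  then have \<gamma>: "\<gamma> \<in> carrier (ly_Aut_stab E (range j))" and K: "wells_K j p s \<gamma> = (id, id)"
    unfolding kernel_def one by simp_all
  have hom: "ly_hom E E \<gamma>" using \<gamma> by (rule Aut_stabD)
  have \<gamma>j: "\<gamma> (j a) = j a" and p\<gamma>: "p (\<gamma> e) = p e" for a e
    using wells_K_intertwines[OF \<gamma>] by (simp_all add: K)
  have lin: "ly_linear E E \<gamma>" using hom by (simp add: ly_hom_def)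
  have "ly_section E G p (\<gamma> \<circ> s)"
    using Vector_Spaces.linear_compose[OF s_linear lin] by (simp add: ly_section_def p\<gamma>)
  then obtain \<phi> where \<phi>: "ly_linear G H \<phi>" "\<gamma> \<circ> s = (\<lambda>x. s x - j (\<phi> x))"
    by (rule section_is_shifted)
  have "\<gamma> e = wells_i j p s \<phi> e" for e
  proof -
    have "\<gamma> (j (q e) + s (p e)) = j (q e) + s (p e) - j (\<phi> (p e))"
      using fun_cong[OF \<phi>(2), of "p e"] by (simp add: ly_hom_rules[OF hom] \<gamma>j)
    then show ?thesis by (simp add: decompose wells_i_eq)
  qed
  then have "\<gamma> = wells_i j p s \<phi>" by blast
  then show "\<gamma> \<in> wells_i j p s ` carrier (Z1_nab G H (induced_cocycle E G j s))"
    using wells_i_hom_iff[OF \<phi>(1)] hom by blast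
qed

lemma twist_in_Z23:
  assumes "\<alpha>\<beta> \<in> carrier (ly_Aut G \<times>\<times> ly_Aut H)"
  shows "twist \<alpha>\<beta> (induced_cocycle E G j s) \<in> Z23_nab G H"
proof -
  obtain \<alpha> \<beta> where eq: "\<alpha>\<beta> = (\<alpha>, \<beta>)" by (cases \<alpha>\<beta>)
  have *: "ly_hom G G \<alpha>" "bij \<alpha>" "ly_hom H H \<beta>" "bij \<beta>"
    using assms by (auto simp: eq DirProd_def ly_Aut_def)
  show ?thesis
    using ly_extension_section.induced_in_Z23[OF twisted_extension(1)[OF *]]
    by (simp only: eq twisted_extension(2)[OF *])
qed

lemma image_wells_K:
  "wells_K j p s ` carrier (ly_Aut_stab E (range j))
    = wells_kernel G H (induced_cocycle E G j s)"
proof (intro equalityI subsetI)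
  fix \<alpha>\<beta>
  {
    assume "\<alpha>\<beta> \<in> wells_K j p s ` carrier (ly_Aut_stab E (range j))"
    then obtain \<gamma> where \<gamma>: "\<gamma> \<in> carrier (ly_Aut_stab E (range j))" and K: "\<alpha>\<beta> = wells_K j p s \<gamma>"
      by blast
    obtain \<alpha> \<beta> where eq: "\<alpha>\<beta> = (\<alpha>, \<beta>)" by (cases \<alpha>\<beta>)
    have Aut: "(\<alpha>, \<beta>) \<in> carrier (ly_Aut G \<times>\<times> ly_Aut H)"
      using wells_K_in_Aut[OF \<gamma>] by (simp only: K[symmetric] eq)
    then have *: "ly_hom G G \<alpha>" "bij \<alpha>" "ly_hom H H \<beta>" "bij \<beta>"
      by (auto simp: DirProd_def ly_Aut_def)
    have \<gamma>j: "\<gamma> (j a) = j (\<beta> a)" and p\<gamma>: "p (\<gamma> e) = \<alpha> (p e)" for a e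
      using wells_K_intertwines[OF \<gamma>] by (simp_all add: K[symmetric] eq)
    have hom: "ly_hom E E \<gamma>" using \<gamma> by (rule Aut_stabD)
    then have lin: "ly_linear E E \<gamma>" by (simp add: ly_hom_def)
    note \<alpha>' = ly_hom_the_inv[OF G.lie_yamaguti_axioms *(1,2)]
    note \<beta>' = ly_hom_the_inv[OF H.lie_yamaguti_axioms *(3,4)]
    have lin': "ly_linear G G (the_inv \<alpha>)" using \<alpha>'(1) by (simp add: ly_hom_def)
    \<comment> \<open>Transporting the section of the twisted extension along \<open>\<gamma>\<close> gives a section of \<open>p\<close>.\<close>
    define s2 where "s2 = \<gamma> \<circ> (s \<circ> the_inv \<alpha>)"
    have "ly_section E G p s2"
      using Vector_Spaces.linear_compose[OF Vector_Spaces.linear_compose[OF lin' s_linear] lin]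
      by (simp add: ly_section_def s2_def p\<gamma> \<alpha>'(3))
    then obtain \<phi> where \<phi>: "ly_linear G H \<phi>" "s2 = (\<lambda>x. s x - j (\<phi> x))"
      by (rule section_is_shifted)
    have ext2: "ly_extension_section H E G j p s2"
      unfolding \<phi>(2) by (rule shifted_section(1)[OF \<phi>(1)])
    interpret tw: ly_extension_section H E G "j \<circ> the_inv \<beta>" "\<alpha> \<circ> p" "s \<circ> the_inv \<alpha>"
      by (rule twisted_extension[OF *])
    have "induced_cocycle E G (j \<circ> the_inv \<beta>) (s \<circ> the_inv \<alpha>) = induced_cocycle E G j s2"
      by (rule iffD1[OF tw.hom_iff_induced_cocycle_eq[OF ext2 lin]])
        (simp_all add: hom \<gamma>j \<beta>'(3) s2_def)
    then have "twist (\<alpha>, \<beta>) (induced_cocycle E G j s) = shift G H \<phi> (induced_cocycle E G j s)"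
      by (simp only: \<phi>(2) twisted_extension(2)[OF *] shifted_section(2)[OF \<phi>(1)])
    then show "\<alpha>\<beta> \<in> wells_kernel G H (induced_cocycle E G j s)"
      using Aut \<phi>(1) unfolding wells_kernel_def eq nab_equivalent_iff_shift by blast
  }
  assume "\<alpha>\<beta> \<in> wells_kernel G H (induced_cocycle E G j s)"
  moreover obtain \<alpha> \<beta> where eq: "\<alpha>\<beta> = (\<alpha>, \<beta>)" by (cases \<alpha>\<beta>)
  ultimately obtain \<phi> where Aut: "(\<alpha>, \<beta>) \<in> carrier (ly_Aut G \<times>\<times> ly_Aut H)"
    and \<phi>: "ly_linear G H \<phi>"
    and c: "twist (\<alpha>, \<beta>) (induced_cocycle E G j s) = shift G H \<phi> (induced_cocycle E G j s)"
    unfolding wells_kernel_def nab_equivalent_iff_shift by blast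
  have *: "ly_hom G G \<alpha>" "bij \<alpha>" "ly_hom H H \<beta>" "bij \<beta>"
    using Aut by (auto simp: DirProd_def ly_Aut_def)
  note \<alpha>' = ly_hom_the_inv[OF G.lie_yamaguti_axioms *(1,2)]
  note \<beta>' = ly_hom_the_inv[OF H.lie_yamaguti_axioms *(3,4)]
  interpret tw: ly_extension_section H E G "j \<circ> the_inv \<beta>" "\<alpha> \<circ> p" "s \<circ> the_inv \<alpha>"
    by (rule twisted_extension[OF *])
  note sh = shifted_section[OF \<phi>]
  \<comment> \<open>The lift of \<open>(\<alpha>, \<beta>)\<close>: it sends \<open>j a + s x\<close> to \<open>j (\<beta> a) + s (\<alpha> x) - j (\<phi> (\<alpha> x))\<close>.\<close>
  define \<gamma> where "\<gamma> = tw.glue j (\<lambda>x. s x - j (\<phi> x))"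
  have hom: "ly_hom E E \<gamma>"
    using tw.hom_iff_induced_cocycle_eq[OF sh(1) tw.glue_linear[OF sh(1)]]
      tw.glue_j[OF sh(1)] tw.glue_s[OF sh(1)] c
    by (simp add: \<gamma>_def sh(2) twisted_extension(2)[OF *])
  have \<gamma>j: "\<gamma> (j a) = j (\<beta> a)" for a
    using tw.glue_j[OF sh(1), of "\<beta> a"] by (simp add: \<gamma>_def \<beta>'(4))
  have p\<gamma>: "p (\<gamma> e) = \<alpha> (p e)" for e
    by (simp add: \<gamma>_def tw.glue_def[OF sh(1)] p_rules)
  have "\<gamma> ` range j = j ` range \<beta>" by (simp add: image_image \<gamma>j)
  then have "\<gamma> ` range j = range j" using *(4) by (simp add: bij_is_surj)
  then have "\<gamma> \<in> carrier (ly_Aut_stab E (range j))"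
    using hom tw.bij_glue[OF sh(1)] by (simp add: ly_Aut_stab_def ly_Aut_def \<gamma>_def)
  moreover have "wells_K j p s \<gamma> = \<alpha>\<beta>" unfolding eq by (rule wells_K_eqI) (fact \<gamma>j p\<gamma>)+
  ultimately show "\<alpha>\<beta> \<in> wells_K j p s ` carrier (ly_Aut_stab E (range j))" by blast
qed

end

text \<open>With \<open>c\<close> as origin, the class of the difference is the class of the twisted cocycle.\<close>

lemma wells_map_eq: "wells_map G H c \<alpha>\<beta> = nab_equiv_rel G H `` {twist \<alpha>\<beta> c}"
  by (simp add: wells_map_def diff_class_def)

theorem theorem6p5:
  fixes H :: "('k::field, 'h::ab_group_add) ly_algebra"
    and E :: "('k, 'e::ab_group_add) ly_algebra"
    and G :: "('k, 'g::ab_group_add) ly_algebra"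
    and j :: "'h \<Rightarrow> 'e" and p :: "'e \<Rightarrow> 'g" and s :: "'g \<Rightarrow> 'e"
  assumes "ly_extension H E G j p"
    and "ly_section E G p s"
  shows
   "let c = induced_cocycle E G j s;
        Z1 = Z1_nab G H c;
        AutE = ly_Aut_stab E (range j);
        AutGH = ly_Aut G \<times>\<times> ly_Aut H;
        i = wells_i j p s;
        K = wells_K j p s;
        W = wells_map G H c
    in comm_group Z1 \<and>
       (\<forall>\<phi> \<in> carrier Z1. \<forall>a x. i \<phi> (j a + s x) = j a + s x - j (\<phi> x)) \<and>
       group_hom Z1 AutE i \<and>
       inj_on i (carrier Z1) \<and>
       group_hom AutE AutGH K \<and>
       i ` carrier Z1 = kernel AutE AutGH K \<and>
       c \<in> Z23_nab G H \<and>
       W \<in> carrier AutGH \<rightarrow> H23_nab G H \<and>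
       wells_kernel G H c = {\<alpha>\<beta> \<in> carrier AutGH. W \<alpha>\<beta> = diff_class G H c 0} \<and>
       K ` carrier AutE = wells_kernel G H c"
proof -
  interpret ly_extension H E G j p by fact
  interpret ly_extension_section H E G j p s by unfold_locales fact
  let ?c = "induced_cocycle E G j s"
  note equiv = equiv_nab_equiv_rel[OF G.lie_yamaguti_axioms H.lie_yamaguti_axioms]
  have W: "wells_map G H ?c \<in> carrier (ly_Aut G \<times>\<times> ly_Aut H) \<rightarrow> H23_nab G H"
    unfolding wells_map_eq H23_nab_def by (intro Pi_I quotientI twist_in_Z23)
  have "nab_equivalent G H (twist \<alpha>\<beta> ?c) ?c \<longleftrightarrow> wells_map G H ?c \<alpha>\<beta> = diff_class G H ?c 0"
    if "\<alpha>\<beta> \<in> carrier (ly_Aut G \<times>\<times> ly_Aut H)" for \<alpha>\<beta>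
    using eq_equiv_class_iff[OF equiv twist_in_Z23[OF that] induced_in_Z23]
      twist_in_Z23[OF that] induced_in_Z23
    by (simp add: wells_map_eq diff_class_def nab_equiv_rel_def)
  then have kernel: "wells_kernel G H ?c =
      {\<alpha>\<beta> \<in> carrier (ly_Aut G \<times>\<times> ly_Aut H). wells_map G H ?c \<alpha>\<beta> = diff_class G H ?c 0}"
    unfolding wells_kernel_def by blast
  show ?thesis
    unfolding Let_def
    using comm_group_Z1_nab[OF G.lie_yamaguti_axioms H.lie_yamaguti_axioms induced_in_Z23]
      group_hom_wells_i inj_on_subset[OF inj_wells_i subset_UNIV] group_hom_wells_K
      image_wells_i induced_in_Z23 W kernel image_wells_K
    by (simp add: wells_i_eq p_rules)
qed

end
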